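(* Let $R$ be a commutative ring. The following statements hold: (1) If $R$ is an $E_2$ ring, then $R$ is a $WZ_2$ ring; if $R$ is an $SE_2$ ring, then $R$ is a $Z_2$ ring. Moreover, if $sr(R)\le 2$ and $R$ is an $E_2$ ring, then $R$ is a $Z_2$ ring. (2) If $R$ is a product of pre-Schreier domains, then $R$ is an $E_2$ ring iff it is a $WZ_2$ ring. (3) If $R$ is a $\Pi_2$ ring, then $R$ is an $SE_2$ ring iff it is a $Z_2$ ring. (4) If $R$ is an $SE_2^{\triangle}$ ring, then $R$ is a $V_2$ ring. If $R$ is an integral domain and an $SE_2^{\triangle}$ ring, then $R$ is a $U_2$ ring. If $R$ is a $\Pi_2$ ring and a $WV_2$ ring, then $R$ is a $U_2$ ring. (5) Assume that $sr(R)\le 4$. If $R$ is an $E_2$ (resp. $SE_2$) ring, then $R/Ra$ is an $E_2$ (resp. $SE_2$) ring for all $a\in R$. (6) If $R/Ra$ is a $\Pi_2$ ring for all $a\in R$, then $R$ is an $E_2$ ring.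
   Context: Rings are commutative with identity; $U(R)$ is the group of units. $Um(R^n)$ is the set of $n$-tuples generating the unit ideal; $Um(\mathbb{M}_2(R))$ is the set of $2\times2$ matrices whose entries generate the unit ideal. $A\in\mathbb{M}_2(R)$ is extendable if there is $A^+\in SL_3(R)$ whose upper-left $2\times 2$ block is $A$; it is simply extendable if $A^+$ can be chosen with $(3,3)$ entry $0$. Two matrices are congruent modulo an ideal $I$ if all entries of their difference lie in $I$. $R$ is: a $\Pi_2$ ring if each $A\in Um(\mathbb{M}_2(R))$ with $\det(A)=0$ is extendable; an $E_2$ (resp. $SE_2$) ring if each matrix in $Um(\mathbb{M}_2(R))$ is extendable (resp. simply extendable); an $SE_2^{\triangle}$ ring if each upper (or lower) triangular matrix in $Um(\mathbb{M}_2(R))$ is simply extendable; a $Z_2$ (resp. $WZ_2$) ring if for each $A\in Um(\mathbb{M}_2(R))$ there exists $B\in Um(\mathbb{M}_2(R))$ (resp. $B\in\mathbb{M}_2(R)$) congruent to $A$ modulo $R\det(A)$ with $\det(B)=0$; a $U_2$ ring if for each $(a,b)\in Um(R^2)$ and $c\in R$ the natural product homomorphism $U(R/Rac)\times U(R/Rbc)\to U(R/Rc)$ (product of the two reductions) is surjective; a $V_2$ ring if for each $(a,b,c)\in Um(R^3)$ there exists $(x,y,z,w)\in R^4$ with $(1-ax)(1-cw)=y(b+acz)$ and $xw=yz$; a $WV_2$ ring if for each $(a,b,c)\in Um(R^3)$ there exist $x,y,z_1,z_2,w,a',c',a'',c''\in R$ such that $(a''-ax,\,y,\,a'c'b+az_1+cz_2,\,c''-cw)\in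 Um(R^4)$, $(a,a'a''),(c,c'c'')\in Um(R^2)$, and $(a''-ax)(c''-cw)=y(a'c'b+az_1+cz_2)$. An integral domain is pre-Schreier if every nonzero element $a$ is primal: whenever $a$ divides a product $bc$, one can write $a=de$ with $d$ dividing $b$ and $e$ dividing $c$. The stable range $sr(R)$ is the smallest $n\ge1$ such that for each $(a_1,\ldots,a_n,b)\in Um(R^{n+1})$ there is $(r_1,\ldots,r_n)\in R^n$ with $(a_1+br_1,\ldots,a_n+br_n)\in Um(R^n)$ ($\infty$ if none exists). *)

theory Defs
  imports "HOL-Algebra.QuotRing" "HOL-Algebra.Divisibility" "HOL-Library.Extended_Nat"
begin

text \<open>
  Rings are records of HOL-Algebra, so that the quotients of a ring are again rings to which the
  definitions below apply.  The zero ring is not excluded by \<^locale>\<open>cring\<close>.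
\<close>

context
  fixes R :: "('a, 'm) ring_scheme" (structure)
begin

text \<open>Tuples are lists; an n-tuple is unimodular if its entries generate the unit ideal.\<close>

definition Um :: "nat \<Rightarrow> 'a list set" where
  "Um n = {v. length v = n \<and> set v \<subseteq> carrier R \<and> Idl (set v) = carrier R}"

text \<open>
  An n-by-n matrix is a function of its row and column indices, counted from 0.  Its values at
  indices \<open>\<ge> n\<close> are arbitrary and never used.
\<close>

definition mats :: "nat \<Rightarrow> (nat \<Rightarrow> nat \<Rightarrow> 'a) set" where
  "mats n = {A. \<forall>i<n. \<forall>j<n. A i j \<in> carrier R}"

definition det2 :: "(nat \<Rightarrow> nat \<Rightarrow> 'a) \<Rightarrow> 'a" where
  "det2 A = A 0 0 \<otimes> A 1 1 \<ominus> A 0 1 \<otimes> A 1 0"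

definition det3 :: "(nat \<Rightarrow> nat \<Rightarrow> 'a) \<Rightarrow> 'a" where
  "det3 A =
    A 0 0 \<otimes> (A 1 1 \<otimes> A 2 2 \<ominus> A 1 2 \<otimes> A 2 1)
    \<ominus> A 0 1 \<otimes> (A 1 0 \<otimes> A 2 2 \<ominus> A 1 2 \<otimes> A 2 0)
    \<oplus> A 0 2 \<otimes> (A 1 0 \<otimes> A 2 1 \<ominus> A 1 1 \<otimes> A 2 0)"

definition SL3 :: "(nat \<Rightarrow> nat \<Rightarrow> 'a) set" where
  "SL3 = {A \<in> mats 3. det3 A = \<one>}"

definition Um_mat2 :: "(nat \<Rightarrow> nat \<Rightarrow> 'a) set" where
  "Um_mat2 = {A \<in> mats 2. Idl {A i j | i j. i < 2 \<and> j < 2} = carrier R}"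

definition extendable :: "(nat \<Rightarrow> nat \<Rightarrow> 'a) \<Rightarrow> bool" where
  "extendable A \<longleftrightarrow> (\<exists>B\<in>SL3. \<forall>i<2. \<forall>j<2. B i j = A i j)"

definition simply_extendable :: "(nat \<Rightarrow> nat \<Rightarrow> 'a) \<Rightarrow> bool" where
  "simply_extendable A \<longleftrightarrow> (\<exists>B\<in>SL3. (\<forall>i<2. \<forall>j<2. B i j = A i j) \<and> B 2 2 = \<zero>)"

definition cong_mat2 :: "'a set \<Rightarrow> (nat \<Rightarrow> nat \<Rightarrow> 'a) \<Rightarrow> (nat \<Rightarrow> nat \<Rightarrow> 'a) \<Rightarrow> bool" where
  "cong_mat2 J A B \<longleftrightarrow> (\<forall>i<2. \<forall>j<2. A i j \<ominus> B i j \<in> J)"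

definition Pi2_ring :: bool where
  "Pi2_ring \<longleftrightarrow> (\<forall>A\<in>Um_mat2. det2 A = \<zero> \<longrightarrow> extendable A)"

definition E2_ring :: bool where
  "E2_ring \<longleftrightarrow> (\<forall>A\<in>Um_mat2. extendable A)"

definition SE2_ring :: bool where
  "SE2_ring \<longleftrightarrow> (\<forall>A\<in>Um_mat2. simply_extendable A)"

definition SE2_triangle_ring :: bool where
  "SE2_triangle_ring \<longleftrightarrow>
    (\<forall>A\<in>Um_mat2. A 1 0 = \<zero> \<or> A 0 1 = \<zero> \<longrightarrow> simply_extendable A)"

definition Z2_ring :: bool where
  "Z2_ring \<longleftrightarrow>
    (\<forall>A\<in>Um_mat2. \<exists>B\<in>Um_mat2. cong_mat2 (PIdl (det2 A)) A B \<and> det2 B = \<zero>)"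

definition WZ2_ring :: bool where
  "WZ2_ring \<longleftrightarrow>
    (\<forall>A\<in>Um_mat2. \<exists>B\<in>mats 2. cong_mat2 (PIdl (det2 A)) A B \<and> det2 B = \<zero>)"

text \<open>
  For ideals \<open>I \<subseteq> J\<close> the reduction \<open>R/I \<rightarrow> R/J\<close> maps a coset \<open>S\<close> of \<open>I\<close> to the coset
  \<open>S + J\<close> of \<open>J\<close>; see \<open>coset_reduction\<close> below.
\<close>

definition unit_product_hom :: "'a \<Rightarrow> 'a set \<times> 'a set \<Rightarrow> 'a set" where
  "unit_product_hom c = (\<lambda>(S, T). (S <+>\<^bsub>R\<^esub> PIdl c) \<otimes>\<^bsub>R Quot PIdl c\<^esub> (T <+>\<^bsub>R\<^esub> PIdl c))"

definition U2_ring :: bool where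
  "U2_ring \<longleftrightarrow>
    (\<forall>a b c. [a, b] \<in> Um 2 \<longrightarrow> c \<in> carrier R \<longrightarrow>
      unit_product_hom c `
          (Units (R Quot PIdl (a \<otimes> c)) \<times> Units (R Quot PIdl (b \<otimes> c)))
        = Units (R Quot PIdl c))"

definition V2_ring :: bool where
  "V2_ring \<longleftrightarrow>
    (\<forall>a b c. [a, b, c] \<in> Um 3 \<longrightarrow>
      (\<exists>x\<in>carrier R. \<exists>y\<in>carrier R. \<exists>z\<in>carrier R. \<exists>w\<in>carrier R.
        (\<one> \<ominus> a \<otimes> x) \<otimes> (\<one> \<ominus> c \<otimes> w) = y \<otimes> (b \<oplus> a \<otimes> c \<otimes> z) \<and>
        x \<otimes> w = y \<otimes> z))"

definition WV2_ring :: bool where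
  "WV2_ring \<longleftrightarrow>
    (\<forall>a b c. [a, b, c] \<in> Um 3 \<longrightarrow>
      (\<exists>x\<in>carrier R. \<exists>y\<in>carrier R. \<exists>z1\<in>carrier R. \<exists>z2\<in>carrier R. \<exists>w\<in>carrier R.
       \<exists>a'\<in>carrier R. \<exists>c'\<in>carrier R. \<exists>a''\<in>carrier R. \<exists>c''\<in>carrier R.
        [a'' \<ominus> a \<otimes> x, y, a' \<otimes> c' \<otimes> b \<oplus> a \<otimes> z1 \<oplus> c \<otimes> z2, c'' \<ominus> c \<otimes> w] \<in> Um 4 \<and>
        [a, a' \<otimes> a''] \<in> Um 2 \<and>
        [c, c' \<otimes> c''] \<in> Um 2 \<and>
        (a'' \<ominus> a \<otimes> x) \<otimes> (c'' \<ominus> c \<otimes> w) =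
          y \<otimes> (a' \<otimes> c' \<otimes> b \<oplus> a \<otimes> z1 \<oplus> c \<otimes> z2)))"

definition primal :: "'a \<Rightarrow> bool" where
  "primal a \<longleftrightarrow>
    (\<forall>b\<in>carrier R. \<forall>c\<in>carrier R. a divides (b \<otimes> c) \<longrightarrow>
      (\<exists>d\<in>carrier R. \<exists>e\<in>carrier R. a = d \<otimes> e \<and> d divides b \<and> e divides c))"

definition pre_schreier_domain :: bool where
  "pre_schreier_domain \<longleftrightarrow> domain R \<and> (\<forall>a\<in>carrier R - {\<zero>}. primal a)"

definition stable_range_condition :: "nat \<Rightarrow> bool" where
  "stable_range_condition n \<longleftrightarrow>
    (\<forall>as b. as @ [b] \<in> Um (n + 1) \<longrightarrow>
      (\<exists>rs. length rs = n \<and> set rs \<subseteq> carrier R \<and>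
        map2 (\<lambda>a r. a \<oplus> b \<otimes> r) as rs \<in> Um n))"

text \<open>The infimum of the empty set in \<^typ>\<open>enat\<close> is \<open>\<infinity>\<close>.\<close>

definition sr :: enat where
  "sr = Inf {enat n | n. n \<ge> 1 \<and> stable_range_condition n}"

end

definition product_ring :: "'i set \<Rightarrow> ('i \<Rightarrow> ('b, 'n) ring_scheme) \<Rightarrow> ('i \<Rightarrow> 'b) ring" where
  "product_ring I D =
    \<lparr>carrier = (\<Pi>\<^sub>E i\<in>I. carrier (D i)),
     monoid.mult = (\<lambda>x y. \<lambda>i\<in>I. x i \<otimes>\<^bsub>D i\<^esub> y i),
     one = (\<lambda>i\<in>I. \<one>\<^bsub>D i\<^esub>),
     zero = (\<lambda>i\<in>I. \<zero>\<^bsub>D i\<^esub>),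
     add = (\<lambda>x y. \<lambda>i\<in>I. x i \<oplus>\<^bsub>D i\<^esub> y i)\<rparr>"

lemma coset_reduction:
  assumes "ideal I R" "ideal J R" "I \<subseteq> J" "x \<in> carrier R"
  shows "(I +>\<^bsub>R\<^esub> x) <+>\<^bsub>R\<^esub> J = J +>\<^bsub>R\<^esub> x"
proof -
  interpret I: ideal I R by fact
  interpret J: ideal J R by fact
  show ?thesis
  proof
    show "(I +>\<^bsub>R\<^esub> x) <+>\<^bsub>R\<^esub> J \<subseteq> J +>\<^bsub>R\<^esub> x"
    proof
      fix y assume "y \<in> (I +>\<^bsub>R\<^esub> x) <+>\<^bsub>R\<^esub> J"
      then obtain i j where ij: "i \<in> I" "j \<in> J" "y = i \<oplus>\<^bsub>R\<^esub> x \<oplus>\<^bsub>R\<^esub> j"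
        by (auto simp: set_add_defs set_mult_def a_r_coset_def r_coset_def)
      then have "i \<in> J" "i \<in> carrier R" "j \<in> carrier R"
        using assms(3) I.Icarr J.Icarr by auto
      then have "y = (i \<oplus>\<^bsub>R\<^esub> j) \<oplus>\<^bsub>R\<^esub> x" "i \<oplus>\<^bsub>R\<^esub> j \<in> J"
        using ij assms(4) by (simp_all add: I.a_ac)
      then show "y \<in> J +>\<^bsub>R\<^esub> x"
        by (auto simp: a_r_coset_def r_coset_def)
    qed
  next
    show "J +>\<^bsub>R\<^esub> x \<subseteq> (I +>\<^bsub>R\<^esub> x) <+>\<^bsub>R\<^esub> J"
    proof
      fix y assume "y \<in> J +>\<^bsub>R\<^esub> x"
      then obtain j where j: "j \<in> J" "y = j \<oplus>\<^bsub>R\<^esub> x"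
        by (auto simp: a_r_coset_def r_coset_def)
      then have "j \<in> carrier R" using J.Icarr by auto
      then have "y = \<zero>\<^bsub>R\<^esub> \<oplus>\<^bsub>R\<^esub> x \<oplus>\<^bsub>R\<^esub> j"
        using j assms(4) by (simp add: I.a_ac)
      moreover have "\<zero>\<^bsub>R\<^esub> \<in> I" by simp
      ultimately show "y \<in> (I +>\<^bsub>R\<^esub> x) <+>\<^bsub>R\<^esub> J"
        using j(1) by (auto simp: set_add_defs set_mult_def a_r_coset_def r_coset_def)
    qed
  qed
qed

end

theory Submission
  imports Defs
begin

text \<open>
  Expanding the determinant along the border, a matrix \<open>A\<close> is extendable iff
  \<open>x\<^sup>T A y + v det A = 1\<close> for some \<open>x, y, v\<close>, and simply extendable iff \<open>v = 0\<close> is possible.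
  So extendability is a statement modulo \<open>det A\<close>, where \<open>A\<close> has determinant 0; and a matrix
  \<open>B\<close> with \<open>det B = 0\<close> and \<open>x\<^sup>T B y = 1\<close> is the product of the column \<open>B y\<close> and the row
  \<open>x\<^sup>T B\<close>. Conversely, if \<open>A\<close> is congruent modulo \<open>det A\<close> to \<open>p q\<^sup>T\<close>, then \<open>p\<close> and \<open>q\<close> are
  unimodular modulo \<open>det A\<close>, which gives \<open>x\<close> and \<open>y\<close>; over a pre-Schreier domain every
  matrix of determinant 0 has the form \<open>p q\<^sup>T\<close>. For \<open>U\<^sub>2\<close> one applies the hypotheses to the
  triple \<open>(ac, d, bc)\<close>, where \<open>d\<close> is a unit modulo \<open>c\<close>.
\<close>

section \<open>Unimodular tuples and extendable matrices\<close>

text \<open>The difficulties sit where a congruence modulo D = det A loses information.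
  Extendability makes w = x^T A y equal to 1 only modulo D, so the singular matrix built from it is
  congruent to A, but a priori the ideal of its entries is only seen to contain w^2. It is
  unimodular once x and y are, and stable range at most 2 moves x and y to unimodular pairs inside
  their classes modulo D. In the other direction, a matrix p q^T congruent to A a priori returns the
  value 1 only modulo D, which is extendability. For simple extendability the value has to be
  exactly 1, and the missing information comes from det A = D, an equation that may not be divided
  by D. The triple for U_2 is chosen because ac and bc generate the same ideal as c, while each
  outer entry vanishes modulo one of the two products: factors that are units modulo ac and modulo
  bc can then be read off from a single relation.\<close>

definition bilin :: "('a, 'm) ring_scheme \<Rightarrow> (nat \<Rightarrow> nat \<Rightarrow> 'a) \<Rightarrow> 'a \<Rightarrow> 'a \<Rightarrow> 'a \<Rightarrow> 'a \<Rightarrow> 'a" where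
  "bilin R A x1 x2 y1 y2 =
    x1 \<otimes>\<^bsub>R\<^esub> (A 0 0 \<otimes>\<^bsub>R\<^esub> y1 \<oplus>\<^bsub>R\<^esub> A 0 1 \<otimes>\<^bsub>R\<^esub> y2) \<oplus>\<^bsub>R\<^esub>
    x2 \<otimes>\<^bsub>R\<^esub> (A 1 0 \<otimes>\<^bsub>R\<^esub> y1 \<oplus>\<^bsub>R\<^esub> A 1 1 \<otimes>\<^bsub>R\<^esub> y2)"

text \<open>Every nonzero index counts as 1. This is harmless, since values outside the 2 by 2 block
  are never inspected.\<close>

definition mat2 :: "'a \<Rightarrow> 'a \<Rightarrow> 'a \<Rightarrow> 'a \<Rightarrow> nat \<Rightarrow> nat \<Rightarrow> 'a" where
  "mat2 a b c d = (\<lambda>i j. if i = 0 then if j = 0 then a else b else if j = 0 then c else d)"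

lemma mat2_simps [simp]:
  "mat2 a b c d 0 0 = a" "mat2 a b c d 0 (Suc 0) = b"
  "mat2 a b c d (Suc 0) 0 = c" "mat2 a b c d (Suc 0) (Suc 0) = d"
  by (simp_all add: mat2_def)

lemma bilin_mat2 [simp]:
  "bilin R (mat2 a b c d) x1 x2 y1 y2 =
    x1 \<otimes>\<^bsub>R\<^esub> (a \<otimes>\<^bsub>R\<^esub> y1 \<oplus>\<^bsub>R\<^esub> b \<otimes>\<^bsub>R\<^esub> y2) \<oplus>\<^bsub>R\<^esub> x2 \<otimes>\<^bsub>R\<^esub> (c \<otimes>\<^bsub>R\<^esub> y1 \<oplus>\<^bsub>R\<^esub> d \<otimes>\<^bsub>R\<^esub> y2)"
  by (simp add: bilin_def)

lemma det2_mat2 [simp]: "det2 R (mat2 a b c d) = a \<otimes>\<^bsub>R\<^esub> d \<ominus>\<^bsub>R\<^esub> b \<otimes>\<^bsub>R\<^esub> c"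
  by (simp add: det2_def)

context cring
begin

lemma Idl_eq_carrier_iff:
  assumes "S \<subseteq> carrier R"
  shows "Idl S = carrier R \<longleftrightarrow> \<one> \<in> Idl S"
  using ideal.one_imp_carrier[OF genideal_ideal[OF assms]] by auto

lemma Idl_empty: "Idl {} = {\<zero>}"
  using genideal_minimal[OF zeroideal, of "{}"]
    additive_subgroup.zero_closed[OF ideal.axioms(1)[OF genideal_ideal[of "{}"]]]
  by auto

text \<open>The ideal generated by x and S is the sum of the principal ideal of x and
  \<open>Idl S\<close>. Since \<open>Idl\<close> is an intersection of ideals, coefficients have to
  be extracted; peeling off one generator at a time turns unimodularity of a short list into an
  explicit linear combination.\<close>

lemma mem_Idl_insert_iff:
  assumes S: "S \<subseteq> carrier R" and x: "x \<in> carrier R"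
  shows "z \<in> Idl (insert x S) \<longleftrightarrow> (\<exists>r\<in>carrier R. \<exists>s\<in>Idl S. r \<otimes> x \<oplus> s = z)"
proof -
  interpret I: ideal "Idl S" R
    by (rule genideal_ideal[OF S])
  interpret J: ideal "Idl (insert x S)" R
    using S x by (intro genideal_ideal) auto
  have sum: "ideal (PIdl x <+>\<^bsub>R\<^esub> Idl S) R"
    by (rule add_ideals[OF cgenideal_ideal[OF x] I.is_ideal])
  have "x = x \<oplus> \<zero>" "x \<in> PIdl x" "\<zero> \<in> Idl S"
    using x by (simp_all add: cgenideal_self)
  then have "x \<in> PIdl x <+>\<^bsub>R\<^esub> Idl S"
    unfolding set_add_def' by blast
  moreover have "s \<in> PIdl x <+>\<^bsub>R\<^esub> Idl S" if "s \<in> S" for s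
  proof -
    have "s = \<zero> \<otimes> x \<oplus> s" "s \<in> Idl S"
      using that S x genideal_self[OF S] by auto
    then show ?thesis
      unfolding set_add_def' cgenideal_def by blast
  qed
  ultimately have "Idl (insert x S) \<subseteq> PIdl x <+>\<^bsub>R\<^esub> Idl S"
    by (intro genideal_minimal[OF sum]) auto
  moreover have "r \<otimes> x \<oplus> s \<in> Idl (insert x S)" if "r \<in> carrier R" "s \<in> Idl S" for r s
  proof -
    have "x \<in> Idl (insert x S)"
      using genideal_self[of "insert x S"] S x by auto
    moreover have "Idl S \<subseteq> Idl (insert x S)"
      using S x by (intro subset_Idl_subset) auto
    ultimately show ?thesis
      using that by (auto intro: J.I_l_closed)
  qed
  ultimately show ?thesis
    by (force simp: set_add_def' cgenideal_def)
qed

lemma Um_iff: "v \<in> Um R n \<longleftrightarrow> length v = n \<and> set v \<subseteq> carrier R \<and> \<one> \<in> Idl (set v)"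
  unfolding Um_def using Idl_eq_carrier_iff by auto

text \<open>After the first generator has been peeled off, the remaining ideal occurs as the range
  of a bounded quantifier; this form continues the expansion there.\<close>

lemma bex_Idl_insert_iff:
  assumes "S \<subseteq> carrier R" and "x \<in> carrier R"
  shows "(\<exists>z\<in>Idl (insert x S). P z) \<longleftrightarrow> (\<exists>r\<in>carrier R. \<exists>s\<in>Idl S. P (r \<otimes> x \<oplus> s))"
proof -
  have "Idl (insert x S) = (\<Union>r\<in>carrier R. (\<lambda>s. r \<otimes> x \<oplus> s) ` (Idl S))"
    unfolding set_eq_iff mem_Idl_insert_iff[OF assms] by blast
  then show ?thesis
    by simp
qed

lemma bex_Idl_singleton_iff:
  assumes "x \<in> carrier R"
  shows "(\<exists>z\<in>Idl {x}. P z) \<longleftrightarrow> (\<exists>r\<in>carrier R. P (r \<otimes> x))"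
  using assms by (simp add: bex_Idl_insert_iff Idl_empty)

lemma Um2_iff:
  "[a, b] \<in> Um R 2 \<longleftrightarrow> a \<in> carrier R \<and> b \<in> carrier R \<and>
     (\<exists>r\<in>carrier R. \<exists>s\<in>carrier R. r \<otimes> a \<oplus> s \<otimes> b = \<one>)"
  by (auto simp: Um_iff mem_Idl_insert_iff bex_Idl_singleton_iff) blast

lemma Um3_iff:
  "[a, b, c] \<in> Um R 3 \<longleftrightarrow> a \<in> carrier R \<and> b \<in> carrier R \<and> c \<in> carrier R \<and>
     (\<exists>r\<in>carrier R. \<exists>s\<in>carrier R. \<exists>t\<in>carrier R. r \<otimes> a \<oplus> (s \<otimes> b \<oplus> t \<otimes> c) = \<one>)"
  by (auto simp: Um_iff mem_Idl_insert_iff bex_Idl_insert_iff[of "{_}"] bex_Idl_singleton_iff)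
    blast

lemma Um4_iff:
  "[a, b, c, d] \<in> Um R 4 \<longleftrightarrow>
     a \<in> carrier R \<and> b \<in> carrier R \<and> c \<in> carrier R \<and> d \<in> carrier R \<and>
     (\<exists>r\<in>carrier R. \<exists>s\<in>carrier R. \<exists>t\<in>carrier R. \<exists>u\<in>carrier R.
       r \<otimes> a \<oplus> (s \<otimes> b \<oplus> (t \<otimes> c \<oplus> u \<otimes> d)) = \<one>)"
  by (auto simp: Um_iff mem_Idl_insert_iff bex_Idl_insert_iff[of "{_}"]
      bex_Idl_insert_iff[of "{_, _}"] bex_Idl_singleton_iff)
    blast

lemma Um_mat2_iff:
  "A \<in> Um_mat2 R \<longleftrightarrow> A \<in> mats R 2 \<and> [A 0 0, A 0 1, A 1 0, A 1 1] \<in> Um R 4"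
proof -
  have "{A i j | i j. i < 2 \<and> j < 2} = {A 0 0, A 0 1, A 1 0, A 1 (1::nat)}"
    by (auto simp: less_2_cases_iff)
  then show ?thesis
    by (auto simp: Um_mat2_def Um_def mats_def)
qed

lemma mats2_iff:
  "A \<in> mats R 2 \<longleftrightarrow>
    A 0 0 \<in> carrier R \<and> A 0 1 \<in> carrier R \<and> A 1 0 \<in> carrier R \<and> A 1 1 \<in> carrier R"
  by (auto simp: mats_def less_2_cases_iff)

lemma bilin_closed [simp]:
  assumes "A \<in> mats R 2" "x1 \<in> carrier R" "x2 \<in> carrier R" "y1 \<in> carrier R" "y2 \<in> carrier R"
  shows "bilin R A x1 x2 y1 y2 \<in> carrier R"
  using assms by (simp add: mats2_iff bilin_def)

lemma det2_closed [simp]: "A \<in> mats R 2 \<Longrightarrow> det2 R A \<in> carrier R"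
  by (simp add: mats2_iff det2_def)

section \<open>Bordered determinants and the bilinear criterion\<close>

lemma det3_expand:
  assumes "a \<in> carrier R" "b \<in> carrier R" "c \<in> carrier R" "d \<in> carrier R"
    "f \<in> carrier R" "g \<in> carrier R" "s \<in> carrier R" "t \<in> carrier R" "v \<in> carrier R"
  shows "a \<otimes> (d \<otimes> v \<ominus> g \<otimes> t) \<ominus> b \<otimes> (c \<otimes> v \<ominus> g \<otimes> s) \<oplus> f \<otimes> (c \<otimes> t \<ominus> d \<otimes> s) =
    (\<ominus> g) \<otimes> (a \<otimes> t \<oplus> b \<otimes> (\<ominus> s)) \<oplus> f \<otimes> (c \<otimes> t \<oplus> d \<otimes> (\<ominus> s)) \<oplus> v \<otimes> (a \<otimes> d \<ominus> b \<otimes> c)"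
  using assms by algebra

text \<open>A bordered determinant is the corner times det A minus row times adj A times column. In
  size 2 the adjugate is the transpose of A conjugated by a quarter turn, so turning the border
  column and the border row replaces adj A by A; this accounts for the swapped and negated
  entries.\<close>

lemma det3_eq_bilin:
  assumes "B \<in> mats R 3" and "\<forall>i<2. \<forall>j<2. B i j = A i j"
  shows "det3 R B =
    bilin R A (\<ominus> B 1 2) (B 0 2) (B 2 1) (\<ominus> B 2 0) \<oplus> B 2 2 \<otimes> det2 R A"
proof -
  have "A 0 0 = B 0 0" "A 0 1 = B 0 1" "A 1 0 = B 1 0" "A 1 1 = B 1 1"
    using assms(2) by simp_all
  then show ?thesis
    using assms(1) unfolding bilin_def det2_def det3_def
    by (subst det3_expand) (auto simp: mats_def)
qed

lemma bordered_matrix: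
  assumes A: "A \<in> mats R 2" and
    "x1 \<in> carrier R" "x2 \<in> carrier R" "y1 \<in> carrier R" "y2 \<in> carrier R" "v \<in> carrier R"
  obtains B where "B \<in> mats R 3" "\<forall>i<2. \<forall>j<2. B i j = A i j" "B 2 2 = v"
    "det3 R B = bilin R A x1 x2 y1 y2 \<oplus> v \<otimes> det2 R A"
proof -
  \<comment> \<open>The border is x and y turned back by a quarter turn, so that
    \<open>det3_eq_bilin\<close> returns exactly x and y.\<close>
  define B where "B i j =
    (if i < 2 then if j < 2 then A i j else if i = 0 then x2 else \<ominus> x1
     else if j = 0 then \<ominus> y2 else if j = 1 then y1 else v)" for i j :: nat
  have B: "B \<in> mats R 3" "\<forall>i<2. \<forall>j<2. B i j = A i j" "B 2 2 = v"
    using assms by (auto simp: mats_def B_def)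
  moreover have "det3 R B = bilin R A x1 x2 y1 y2 \<oplus> v \<otimes> det2 R A"
  proof -
    have "\<ominus> B 1 2 = x1" "B 0 2 = x2" "B 2 1 = y1" "\<ominus> B 2 0 = y2"
      using assms by (simp_all add: B_def)
    then show ?thesis
      using det3_eq_bilin[OF B(1,2)] B(3) by simp
  qed
  ultimately show ?thesis
    using that by blast
qed

lemma extendable_iff:
  assumes A: "A \<in> mats R 2"
  shows "extendable R A \<longleftrightarrow>
    (\<exists>x1\<in>carrier R. \<exists>x2\<in>carrier R. \<exists>y1\<in>carrier R. \<exists>y2\<in>carrier R. \<exists>v\<in>carrier R.
      bilin R A x1 x2 y1 y2 \<oplus> v \<otimes> det2 R A = \<one>)" (is "_ \<longleftrightarrow> ?rhs")
proof
  assume "extendable R A"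
  then obtain B where "B \<in> mats R 3" "det3 R B = \<one>" "\<forall>i<2. \<forall>j<2. B i j = A i j"
    by (auto simp: extendable_def SL3_def)
  moreover from this have
    "\<ominus> B 1 2 \<in> carrier R" "B 0 2 \<in> carrier R" "B 2 1 \<in> carrier R" "\<ominus> B 2 0 \<in> carrier R"
    "B 2 2 \<in> carrier R"
    by (auto simp: mats_def)
  ultimately show ?rhs
    using det3_eq_bilin by metis
next
  assume ?rhs
  then obtain x1 x2 y1 y2 v where x: "x1 \<in> carrier R" "x2 \<in> carrier R" "y1 \<in> carrier R"
    "y2 \<in> carrier R" "v \<in> carrier R" "bilin R A x1 x2 y1 y2 \<oplus> v \<otimes> det2 R A = \<one>"
    by blast
  obtain B where "B \<in> mats R 3" "\<forall>i<2. \<forall>j<2. B i j = A i j"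
    "det3 R B = bilin R A x1 x2 y1 y2 \<oplus> v \<otimes> det2 R A"
    using bordered_matrix[OF A x(1-5)] by blast
  then show "extendable R A"
    unfolding extendable_def SL3_def using x(6) by auto
qed

lemma simply_extendable_iff:
  assumes A: "A \<in> mats R 2"
  shows "simply_extendable R A \<longleftrightarrow>
    (\<exists>x1\<in>carrier R. \<exists>x2\<in>carrier R. \<exists>y1\<in>carrier R. \<exists>y2\<in>carrier R.
      bilin R A x1 x2 y1 y2 = \<one>)" (is "_ \<longleftrightarrow> ?rhs")
proof
  assume "simply_extendable R A"
  then obtain B where B: "B \<in> mats R 3" "det3 R B = \<one>" "\<forall>i<2. \<forall>j<2. B i j = A i j" "B 2 2 = \<zero>"
    by (auto simp: simply_extendable_def SL3_def)
  then have carr: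
    "\<ominus> B 1 2 \<in> carrier R" "B 0 2 \<in> carrier R" "B 2 1 \<in> carrier R" "\<ominus> B 2 0 \<in> carrier R"
    by (auto simp: mats_def)
  have "bilin R A (\<ominus> B 1 2) (B 0 2) (B 2 1) (\<ominus> B 2 0) = \<one>"
    using det3_eq_bilin[OF B(1,3)] B A carr by simp
  with carr show ?rhs
    by blast
next
  assume ?rhs
  then obtain x1 x2 y1 y2 where x: "x1 \<in> carrier R" "x2 \<in> carrier R" "y1 \<in> carrier R"
    "y2 \<in> carrier R" "bilin R A x1 x2 y1 y2 = \<one>"
    by blast
  obtain B where "B \<in> mats R 3" "\<forall>i<2. \<forall>j<2. B i j = A i j" "B 2 2 = \<zero>"
    "det3 R B = bilin R A x1 x2 y1 y2 \<oplus> \<zero> \<otimes> det2 R A"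
    using bordered_matrix[OF A x(1-4) zero_closed] by blast
  then show "simply_extendable R A"
    unfolding simply_extendable_def SL3_def using x(5) A by auto
qed

text \<open>The corner entry enters the bordered determinant only through its product with det A, so
  it may be replaced by 0.\<close>

lemma extendable_det_zero:
  assumes "A \<in> mats R 2" "det2 R A = \<zero>" "extendable R A"
  shows "simply_extendable R A"
proof -
  from assms show ?thesis
    by (auto simp: extendable_iff simply_extendable_iff)
qed

text \<open>The value x^T A y is a linear combination of the entries of A.\<close>

lemma bilin_imp_Um_mat2:
  assumes A: "A \<in> mats R 2"
    and "x1 \<in> carrier R" "x2 \<in> carrier R" "y1 \<in> carrier R" "y2 \<in> carrier R"
    and "bilin R A x1 x2 y1 y2 = \<one>"
  shows "A \<in> Um_mat2 R"
proof -
  let ?S = "{A 0 0, A 0 1, A 1 0, A 1 1}"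
  have S: "?S \<subseteq> carrier R"
    using A by (simp add: mats2_iff)
  interpret I: ideal "Idl ?S" R
    by (rule genideal_ideal[OF S])
  have "A 0 0 \<in> Idl ?S" "A 0 1 \<in> Idl ?S" "A 1 0 \<in> Idl ?S" "A 1 1 \<in> Idl ?S"
    using genideal_self[OF S] by auto
  then have "bilin R A x1 x2 y1 y2 \<in> Idl ?S"
    using assms unfolding bilin_def by (intro I.a_closed I.I_l_closed I.I_r_closed)
  then show ?thesis
    using assms S by (simp add: Um_mat2_iff Um_iff)
qed

section \<open>Reduction modulo the determinant\<close>

lemma mat2_in_mats [simp]:
  "mat2 a b c d \<in> mats R 2 \<longleftrightarrow> a \<in> carrier R \<and> b \<in> carrier R \<and> c \<in> carrier R \<and> d \<in> carrier R"
  by (auto simp: mats2_iff)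

lemma cong_mat2_iff:
  "cong_mat2 R J A B \<longleftrightarrow> A 0 0 \<ominus> B 0 0 \<in> J \<and> A 0 1 \<ominus> B 0 1 \<in> J \<and>
    A 1 0 \<ominus> B 1 0 \<in> J \<and> A 1 1 \<ominus> B 1 1 \<in> J"
  by (auto simp: cong_mat2_def less_2_cases_iff)

lemma eq_add_of_minus_mem_PIdl:
  assumes "a \<ominus> b \<in> PIdl d" "a \<in> carrier R" "b \<in> carrier R" "d \<in> carrier R"
  obtains n where "n \<in> carrier R" "a = b \<oplus> d \<otimes> n"
proof -
  obtain n where n: "n \<in> carrier R" "a \<ominus> b = n \<otimes> d"
    using assms(1) by (auto simp: cgenideal_def)
  have "a = b \<oplus> (a \<ominus> b)"
    using assms by algebra
  with n assms(4) that show ?thesis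
    by (simp add: m_comm)
qed

lemma minus_mem_PIdlI:
  assumes "a = b \<oplus> d \<otimes> n" "n \<in> carrier R" "b \<in> carrier R" "d \<in> carrier R"
  shows "a \<ominus> b \<in> PIdl d"
proof -
  have "(b \<oplus> d \<otimes> n) \<ominus> b = n \<otimes> d"
    using assms(2-) by algebra
  then show ?thesis
    using assms by (auto simp: cgenideal_def)
qed

text \<open>The matrix has the form w A - D p q^T. Its determinant has no term in D^2 because p q^T
  is singular, and the remaining bracket vanishes when w = x^T A y and D = det A.\<close>

lemma det_reduction_identity:
  assumes "a \<in> carrier R" "b \<in> carrier R" "c \<in> carrier R" "d \<in> carrier R" "w \<in> carrier R"
    "D \<in> carrier R" "x1 \<in> carrier R" "x2 \<in> carrier R" "y1 \<in> carrier R" "y2 \<in> carrier R"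
  shows "(w \<otimes> a \<ominus> D \<otimes> (x2 \<otimes> y2)) \<otimes> (w \<otimes> d \<ominus> D \<otimes> (x1 \<otimes> y1)) \<ominus>
      (w \<otimes> b \<oplus> D \<otimes> (x2 \<otimes> y1)) \<otimes> (w \<otimes> c \<oplus> D \<otimes> (x1 \<otimes> y2)) =
    w \<otimes> (w \<otimes> (a \<otimes> d \<ominus> b \<otimes> c) \<ominus>
      D \<otimes> (x1 \<otimes> (a \<otimes> y1 \<oplus> b \<otimes> y2) \<oplus> x2 \<otimes> (c \<otimes> y1 \<oplus> d \<otimes> y2)))"
  using assms by algebra

text \<open>The correction p q^T is invisible to x and y, because p = (-x2, x1) is orthogonal to x
  and q = (-y2, y1) is orthogonal to y.\<close>

lemma bilin_reduction_identity:
  assumes "a \<in> carrier R" "b \<in> carrier R" "c \<in> carrier R" "d \<in> carrier R" "w \<in> carrier R"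
    "D \<in> carrier R" "x1 \<in> carrier R" "x2 \<in> carrier R" "y1 \<in> carrier R" "y2 \<in> carrier R"
  shows "x1 \<otimes> ((w \<otimes> a \<ominus> D \<otimes> (x2 \<otimes> y2)) \<otimes> y1 \<oplus> (w \<otimes> b \<oplus> D \<otimes> (x2 \<otimes> y1)) \<otimes> y2) \<oplus>
      x2 \<otimes> ((w \<otimes> c \<oplus> D \<otimes> (x1 \<otimes> y2)) \<otimes> y1 \<oplus> (w \<otimes> d \<ominus> D \<otimes> (x1 \<otimes> y1)) \<otimes> y2) =
    w \<otimes> (x1 \<otimes> (a \<otimes> y1 \<oplus> b \<otimes> y2) \<oplus> x2 \<otimes> (c \<otimes> y1 \<oplus> d \<otimes> y2))"
  using assms by algebra

text \<open>
  With \<open>w = x\<^sup>T A y\<close>, \<open>p = (-x2, x1)\<close> and \<open>q = (-y2, y1)\<close> this is \<open>w A - (det A) p q\<^sup>T\<close>. It is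
  congruent to \<open>A\<close> when \<open>w\<close> is 1 modulo \<open>det A\<close>, and its determinant vanishes because
  \<open>q\<^sup>T adj(A) p = w\<close>.
\<close>

definition reduction :: "(nat \<Rightarrow> nat \<Rightarrow> 'a) \<Rightarrow> 'a \<Rightarrow> 'a \<Rightarrow> 'a \<Rightarrow> 'a \<Rightarrow> nat \<Rightarrow> nat \<Rightarrow> 'a" where
  "reduction A x1 x2 y1 y2 =
    (let w = bilin R A x1 x2 y1 y2; D = det2 R A in
     mat2 (w \<otimes> A 0 0 \<ominus> D \<otimes> (x2 \<otimes> y2)) (w \<otimes> A 0 1 \<oplus> D \<otimes> (x2 \<otimes> y1))
       (w \<otimes> A 1 0 \<oplus> D \<otimes> (x1 \<otimes> y2)) (w \<otimes> A 1 1 \<ominus> D \<otimes> (x1 \<otimes> y1)))"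

context
  fixes A x1 x2 y1 y2
  assumes A: "A \<in> mats R 2" and
    xy: "x1 \<in> carrier R" "x2 \<in> carrier R" "y1 \<in> carrier R" "y2 \<in> carrier R"
begin

lemma reduction_closed [simp]: "reduction A x1 x2 y1 y2 \<in> mats R 2"
proof -
  have "bilin R A x1 x2 y1 y2 \<in> carrier R" "det2 R A \<in> carrier R"
    using A xy by simp_all
  then show ?thesis
    using A xy by (simp add: reduction_def Let_def mats2_iff)
qed

lemma det2_reduction: "det2 R (reduction A x1 x2 y1 y2) = \<zero>"
proof -
  define w D where "w = bilin R A x1 x2 y1 y2" and "D = det2 R A"
  have w: "w \<in> carrier R" "D \<in> carrier R"
    using A xy by (simp_all add: w_def D_def)
  have "det2 R (reduction A x1 x2 y1 y2) =
      w \<otimes> (w \<otimes> (A 0 0 \<otimes> A 1 1 \<ominus> A 0 1 \<otimes> A 1 0) \<ominus> D \<otimes> bilin R A x1 x2 y1 y2)"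
    using det_reduction_identity[of "A 0 0" "A 0 1" "A 1 0" "A 1 1" w D x1 x2 y1 y2] A xy w
    by (simp add: reduction_def Let_def flip: w_def D_def) (simp add: mats2_iff bilin_def w_def)
  also have "\<dots> = w \<otimes> (w \<otimes> D \<ominus> D \<otimes> w)"
    by (simp add: w_def D_def det2_def)
  also have "\<dots> = \<zero>"
    using w by algebra
  finally show ?thesis .
qed

lemma bilin_reduction:
  "bilin R (reduction A x1 x2 y1 y2) x1 x2 y1 y2 = bilin R A x1 x2 y1 y2 \<otimes> bilin R A x1 x2 y1 y2"
proof -
  define w D where "w = bilin R A x1 x2 y1 y2" and "D = det2 R A"
  have w: "w \<in> carrier R" "D \<in> carrier R"
    using A xy by (simp_all add: w_def D_def)
  have "bilin R (reduction A x1 x2 y1 y2) x1 x2 y1 y2 = w \<otimes> bilin R A x1 x2 y1 y2"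
    using bilin_reduction_identity[of "A 0 0" "A 0 1" "A 1 0" "A 1 1" w D x1 x2 y1 y2] A xy w
    by (simp add: reduction_def Let_def flip: w_def D_def) (simp add: mats2_iff bilin_def w_def)
  then show ?thesis
    by (simp add: w_def)
qed

lemma cong_reduction:
  assumes v: "v \<in> carrier R" and w_eq: "bilin R A x1 x2 y1 y2 \<oplus> v \<otimes> det2 R A = \<one>"
  shows "cong_mat2 R (PIdl (det2 R A)) A (reduction A x1 x2 y1 y2)"
proof -
  define w D where "w = bilin R A x1 x2 y1 y2" and "D = det2 R A"
  have w: "w \<in> carrier R" "D \<in> carrier R" "w \<oplus> v \<otimes> D = \<one>"
    using A xy w_eq by (simp_all add: w_def D_def)
  have plus: "a \<ominus> (w \<otimes> a \<oplus> D \<otimes> u) \<in> PIdl D" if "a \<in> carrier R" "u \<in> carrier R" for a u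
  proof (rule minus_mem_PIdlI)
    \<comment> \<open>Multiplying w + v D = 1 by the entry a produces the cofactor of D.\<close>
    have "(w \<oplus> v \<otimes> D) \<otimes> a = w \<otimes> a \<oplus> D \<otimes> u \<oplus> D \<otimes> (v \<otimes> a \<ominus> u)"
      using that w(1,2) v by algebra
    then show "a = w \<otimes> a \<oplus> D \<otimes> u \<oplus> D \<otimes> (v \<otimes> a \<ominus> u)"
      using w(3) that by simp
  qed (use that w v in simp_all)
  moreover have "a \<ominus> (w \<otimes> a \<ominus> D \<otimes> u) \<in> PIdl D" if "a \<in> carrier R" "u \<in> carrier R" for a u
    using plus[of a "\<ominus> u"] that w by (simp add: a_minus_def r_minus)
  ultimately show ?thesis
    using A xy by (simp add: cong_mat2_iff reduction_def Let_def mats2_iff flip: w_def D_def)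
qed

end

lemma E2_imp_WZ2:
  assumes "E2_ring R" shows "WZ2_ring R"
  unfolding WZ2_ring_def
proof
  fix A assume "A \<in> Um_mat2 R"
  with assms have A: "A \<in> mats R 2" "extendable R A"
    by (auto simp: E2_ring_def Um_mat2_def)
  then obtain x1 x2 y1 y2 v where "x1 \<in> carrier R" "x2 \<in> carrier R" "y1 \<in> carrier R"
    "y2 \<in> carrier R" "v \<in> carrier R" "bilin R A x1 x2 y1 y2 \<oplus> v \<otimes> det2 R A = \<one>"
    by (auto simp: extendable_iff)
  with A(1) show "\<exists>B\<in>mats R 2. cong_mat2 R (PIdl (det2 R A)) A B \<and> det2 R B = \<zero>"
    by (intro bexI[of _ "reduction A x1 x2 y1 y2"] conjI cong_reduction det2_reduction) simp_all
qed

text \<open>Here w = 1, so the reduction takes the value w^2 = 1 at the same x and y and is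
  unimodular for that reason; the congruence is the case v = 0.\<close>

lemma SE2_imp_Z2:
  assumes "SE2_ring R" shows "Z2_ring R"
  unfolding Z2_ring_def
proof
  fix A assume "A \<in> Um_mat2 R"
  with assms have A: "A \<in> mats R 2" "simply_extendable R A"
    by (auto simp: SE2_ring_def Um_mat2_def)
  then obtain x1 x2 y1 y2 where x: "x1 \<in> carrier R" "x2 \<in> carrier R" "y1 \<in> carrier R"
    "y2 \<in> carrier R" "bilin R A x1 x2 y1 y2 = \<one>"
    by (auto simp: simply_extendable_iff)
  have "reduction A x1 x2 y1 y2 \<in> Um_mat2 R"
    using bilin_reduction[OF A(1) x(1-4)] A(1) x by (intro bilin_imp_Um_mat2) simp_all
  moreover have "cong_mat2 R (PIdl (det2 R A)) A (reduction A x1 x2 y1 y2)"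
    using x A(1) by (intro cong_reduction[where v = \<zero>]) simp_all
  ultimately show "\<exists>B\<in>Um_mat2 R. cong_mat2 R (PIdl (det2 R A)) A B \<and> det2 R B = \<zero>"
    using det2_reduction[OF A(1) x(1-4)] by blast
qed

text \<open>Write the reduction B as w A - D p q^T and let J be the ideal of its entries. Then w^2 =
  x^T B y lies in J. As x and y are unimodular, the entries of p q^T generate the unit ideal, so e
  lies in J as soon as all products of e with these entries do. Modulo w^2 this yields D w in J,
  hence w = w^2 + v D w in J, hence D in J, and finally 1 = w + v D in J.\<close>

lemma reduction_in_Um_mat2:
  assumes A: "A \<in> mats R 2" and v: "v \<in> carrier R"
    and eq: "bilin R A x1 x2 y1 y2 \<oplus> v \<otimes> det2 R A = \<one>"
    and x: "[x1, x2] \<in> Um R 2" and y: "[y1, y2] \<in> Um R 2"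
  shows "reduction A x1 x2 y1 y2 \<in> Um_mat2 R"
proof -
  define w D B where "w = bilin R A x1 x2 y1 y2" and "D = det2 R A"
    and "B = reduction A x1 x2 y1 y2"
  obtain r s where r: "r \<in> carrier R" "s \<in> carrier R" "r \<otimes> x1 \<oplus> s \<otimes> x2 = \<one>"
    using x by (auto simp: Um2_iff)
  obtain t u where t: "t \<in> carrier R" "u \<in> carrier R" "t \<otimes> y1 \<oplus> u \<otimes> y2 = \<one>"
    using y by (auto simp: Um2_iff)
  have xy: "x1 \<in> carrier R" "x2 \<in> carrier R" "y1 \<in> carrier R" "y2 \<in> carrier R"
    using x y by (auto simp: Um2_iff)
  have w: "w \<in> carrier R" "D \<in> carrier R" "w \<oplus> v \<otimes> D = \<one>"
    using A xy eq by (simp_all add: w_def D_def)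
  have B: "B \<in> mats R 2"
    using A xy by (simp add: B_def)
  define J where "J = Idl {B 0 0, B 0 1, B 1 0, B 1 1}"
  have sub: "{B 0 0, B 0 1, B 1 0, B 1 1} \<subseteq> carrier R"
    using B by (simp add: mats2_iff)
  interpret J: ideal J R
    unfolding J_def by (rule genideal_ideal[OF sub])
  have gen: "B 0 0 \<in> J" "B 0 1 \<in> J" "B 1 0 \<in> J" "B 1 1 \<in> J"
    using genideal_self[OF sub] by (auto simp: J_def)
  then have "bilin R B x1 x2 y1 y2 \<in> J"
    using xy unfolding bilin_def by (intro J.a_closed J.I_l_closed J.I_r_closed)
  then have ww: "w \<otimes> w \<in> J"
    using bilin_reduction[OF A xy] by (simp add: B_def w_def)
  have entries: "B 0 0 = w \<otimes> A 0 0 \<oplus> D \<otimes> (\<ominus> (x2 \<otimes> y2))" "B 0 1 = w \<otimes> A 0 1 \<oplus> D \<otimes> (x2 \<otimes> y1)"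
    "B 1 0 = w \<otimes> A 1 0 \<oplus> D \<otimes> (x1 \<otimes> y2)" "B 1 1 = w \<otimes> A 1 1 \<oplus> D \<otimes> (\<ominus> (x1 \<otimes> y1))"
    using A w(1,2) xy
    by (simp_all add: B_def reduction_def Let_def a_minus_def r_minus mats2_iff flip: w_def D_def)
  note gen' = gen[unfolded entries]
  \<comment> \<open>The coefficients arise from expanding e times the product of the two Bezout
    relations; the signs compensate those of the correction term.\<close>
  have comb: "e \<in> J" if e: "e \<in> carrier R" and mem: "e \<otimes> (\<ominus> (x2 \<otimes> y2)) \<in> J"
    "e \<otimes> (x2 \<otimes> y1) \<in> J" "e \<otimes> (x1 \<otimes> y2) \<in> J" "e \<otimes> (\<ominus> (x1 \<otimes> y1)) \<in> J" for e
  proof -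
    have "e = e \<otimes> ((r \<otimes> x1 \<oplus> s \<otimes> x2) \<otimes> (t \<otimes> y1 \<oplus> u \<otimes> y2))"
      using e r(3) t(3) by simp
    also have "\<dots> = (\<ominus> (s \<otimes> u)) \<otimes> (e \<otimes> (\<ominus> (x2 \<otimes> y2))) \<oplus> (s \<otimes> t) \<otimes> (e \<otimes> (x2 \<otimes> y1)) \<oplus>
      ((r \<otimes> u) \<otimes> (e \<otimes> (x1 \<otimes> y2)) \<oplus> (\<ominus> (r \<otimes> t)) \<otimes> (e \<otimes> (\<ominus> (x1 \<otimes> y1))))"
      using e r(1,2) t(1,2) xy by algebra
    also have "\<dots> \<in> J"
      using mem r(1,2) t(1,2) by (simp add: J.a_closed J.I_l_closed)
    finally show ?thesis .
  qed
  \<comment> \<open>Multiplying an entry by w turns its part w a into a multiple of w^2, which is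
    already in J.\<close>
  have mod_w: "(D \<otimes> w) \<otimes> z \<in> J"
    if "w \<otimes> a \<oplus> D \<otimes> z \<in> J" "a \<in> carrier R" "z \<in> carrier R" for a z
  proof -
    have "(D \<otimes> w) \<otimes> z = w \<otimes> (w \<otimes> a \<oplus> D \<otimes> z) \<oplus> (\<ominus> a) \<otimes> (w \<otimes> w)"
      using that(2,3) w(1,2) by algebra
    then show ?thesis
      using that ww w by (simp add: J.I_l_closed J.a_closed)
  qed
  have "D \<otimes> w \<in> J"
    using A xy w
    by (intro comb[OF _ mod_w[OF gen'(1)] mod_w[OF gen'(2)] mod_w[OF gen'(3)] mod_w[OF gen'(4)]])
      (simp_all add: mats2_iff)
  moreover have "w = w \<otimes> (w \<oplus> v \<otimes> D)"
    using w by simp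
  moreover have "w \<otimes> (w \<oplus> v \<otimes> D) = w \<otimes> w \<oplus> v \<otimes> (D \<otimes> w)"
    using w(1,2) v by algebra
  ultimately have wJ: "w \<in> J"
    using ww v by (metis J.a_closed J.I_l_closed)
  have mod_D: "D \<otimes> z \<in> J"
    if "w \<otimes> a \<oplus> D \<otimes> z \<in> J" "a \<in> carrier R" "z \<in> carrier R" for a z
  proof -
    have "D \<otimes> z = (w \<otimes> a \<oplus> D \<otimes> z) \<oplus> (\<ominus> a) \<otimes> w"
      using that(2,3) w(1,2) by algebra
    then show ?thesis
      using that wJ by (metis J.I_l_closed J.a_closed a_inv_closed)
  qed
  have "D \<in> J"
    using A xy w
    by (intro comb[OF _ mod_D[OF gen'(1)] mod_D[OF gen'(2)] mod_D[OF gen'(3)] mod_D[OF gen'(4)]])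
      (simp_all add: mats2_iff)
  then have "w \<oplus> v \<otimes> D \<in> J"
    using wJ v by (intro J.a_closed J.I_l_closed)
  then show ?thesis
    using B sub w(3) by (simp add: Um_mat2_iff Um_iff J_def flip: B_def)
qed

section \<open>Multiplicativity of 2 by 2 determinants\<close>

lemma det_product_identity:
  assumes "a \<in> carrier R" "b \<in> carrier R" "c \<in> carrier R" "d \<in> carrier R"
    "y1 \<in> carrier R" "y2 \<in> carrier R" "z1 \<in> carrier R" "z2 \<in> carrier R"
  shows "(a \<otimes> y1 \<oplus> b \<otimes> y2) \<otimes> (c \<otimes> z1 \<oplus> d \<otimes> z2) \<ominus> (a \<otimes> z1 \<oplus> b \<otimes> z2) \<otimes> (c \<otimes> y1 \<oplus> d \<otimes> y2) =
    (a \<otimes> d \<ominus> b \<otimes> c) \<otimes> (y1 \<otimes> z2 \<ominus> y2 \<otimes> z1)"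
  using assms by algebra

lemma bilin_expand:
  assumes "A \<in> mats R 2" "x1 \<in> carrier R" "x2 \<in> carrier R" "y1 \<in> carrier R" "y2 \<in> carrier R"
  shows "bilin R A x1 x2 y1 y2 =
    (A 0 0 \<otimes> x1 \<oplus> A 1 0 \<otimes> x2) \<otimes> y1 \<oplus> (A 0 1 \<otimes> x1 \<oplus> A 1 1 \<otimes> x2) \<otimes> y2"
  using assms unfolding bilin_def mats2_iff by algebra

text \<open>This is det(P^T A Q) = det A det P det Q, where P has columns x, u and Q has columns y,
  z. The product rule for determinants is applied twice, once to the rows x^T A and u^T A against Q
  and once to A^T against P.\<close>

lemma cauchy_binet:
  assumes A: "A \<in> mats R 2"
    and x: "x1 \<in> carrier R" "x2 \<in> carrier R" and y: "y1 \<in> carrier R" "y2 \<in> carrier R"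
    and u: "u1 \<in> carrier R" "u2 \<in> carrier R" and z: "z1 \<in> carrier R" "z2 \<in> carrier R"
  shows "bilin R A x1 x2 y1 y2 \<otimes> bilin R A u1 u2 z1 z2 \<ominus> bilin R A x1 x2 z1 z2 \<otimes> bilin R A u1 u2 y1 y2 =
    det2 R A \<otimes> (x1 \<otimes> u2 \<ominus> x2 \<otimes> u1) \<otimes> (y1 \<otimes> z2 \<ominus> y2 \<otimes> z1)"
proof -
  define r1 r2 where "r1 = A 0 0 \<otimes> x1 \<oplus> A 1 0 \<otimes> x2" and "r2 = A 0 1 \<otimes> x1 \<oplus> A 1 1 \<otimes> x2"
  define s1 s2 where "s1 = A 0 0 \<otimes> u1 \<oplus> A 1 0 \<otimes> u2" and "s2 = A 0 1 \<otimes> u1 \<oplus> A 1 1 \<otimes> u2"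
  have carr: "r1 \<in> carrier R" "r2 \<in> carrier R" "s1 \<in> carrier R" "s2 \<in> carrier R"
    using A x u by (simp_all add: r1_def r2_def s1_def s2_def mats2_iff)
  have "bilin R A x1 x2 y1 y2 \<otimes> bilin R A u1 u2 z1 z2 \<ominus> bilin R A x1 x2 z1 z2 \<otimes> bilin R A u1 u2 y1 y2 =
      (r1 \<otimes> s2 \<ominus> r2 \<otimes> s1) \<otimes> (y1 \<otimes> z2 \<ominus> y2 \<otimes> z1)"
    unfolding bilin_expand[OF A x y] bilin_expand[OF A x z] bilin_expand[OF A u y]
      bilin_expand[OF A u z] r1_def[symmetric] r2_def[symmetric] s1_def[symmetric] s2_def[symmetric]
    using carr y z by (rule det_product_identity)
  \<comment> \<open>The vectors r and s are the columns of A^T P; the factors are swapped to match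
    the product rule for A^T.\<close>
  also have "r1 \<otimes> s2 \<ominus> r2 \<otimes> s1 = r1 \<otimes> s2 \<ominus> s1 \<otimes> r2"
    using carr by (simp add: m_comm)
  also have "\<dots> = (A 0 0 \<otimes> A 1 1 \<ominus> A 1 0 \<otimes> A 0 1) \<otimes> (x1 \<otimes> u2 \<ominus> x2 \<otimes> u1)"
    unfolding r1_def r2_def s1_def s2_def
    using A x u by (intro det_product_identity) (simp_all add: mats2_iff)
  also have "A 0 0 \<otimes> A 1 1 \<ominus> A 1 0 \<otimes> A 0 1 = det2 R A"
    using A by (simp add: det2_def mats2_iff m_comm)
  finally show ?thesis .
qed

section \<open>Stable range\<close>

text \<open>\<open>sr\<close> only names the least n, so the condition has to be carried upwards.
  Merging the head a0 with b into b' = r a0 + y b shortens the unimodular tuple by one. Corrections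
  by b' t are then replaced by corrections by b y t; the difference r t a0 is a multiple of the
  head, which stays in the tuple.\<close>

lemma stable_range_condition_Suc:
  assumes "stable_range_condition R n"
  shows "stable_range_condition R (Suc n)"
  unfolding stable_range_condition_def
proof (intro allI impI)
  fix as b assume um: "as @ [b] \<in> Um R (Suc n + 1)"
  then obtain a0 as' where as: "as = a0 # as'" "length as' = n"
    by (cases as) (auto simp: Um_iff)
  with um have carr: "a0 \<in> carrier R" "b \<in> carrier R" "set as' \<subseteq> carrier R"
    and one: "\<one> \<in> Idl (insert a0 (insert b (set as')))"
    by (auto simp: Um_iff insert_commute)
  then obtain r y s where rys: "r \<in> carrier R" "y \<in> carrier R" "s \<in> Idl (set as')"
    "r \<otimes> a0 \<oplus> (y \<otimes> b \<oplus> s) = \<one>"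
    by (auto simp: mem_Idl_insert_iff bex_Idl_insert_iff)
  define b' where "b' = r \<otimes> a0 \<oplus> y \<otimes> b"
  have b': "b' \<in> carrier R"
    using carr rys by (simp add: b'_def)
  have s: "s \<in> carrier R"
    using rys(3) carr(3) genideal_ideal ideal.Icarr by metis
  have "\<one> \<otimes> b' \<oplus> s = \<one>"
    using rys carr s by (simp add: b'_def a_assoc)
  then have "\<one> \<in> Idl (insert b' (set as'))"
    unfolding mem_Idl_insert_iff[OF carr(3) b'] using rys(3) by blast
  then have "as' @ [b'] \<in> Um R (n + 1)"
    using as(2) carr b' by (simp add: Um_iff)
  then obtain rs where rs: "length rs = n" "set rs \<subseteq> carrier R"
    and um': "map2 (\<lambda>a r. a \<oplus> b' \<otimes> r) as' rs \<in> Um R n"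
    using assms unfolding stable_range_condition_def by blast
  \<comment> \<open>The coefficient 0 leaves the head unchanged, which makes its multiples available
    for repairing the tail.\<close>
  define rs' where "rs' = \<zero> # map (\<lambda>r. y \<otimes> r) rs"
  define v where "v = map2 (\<lambda>a r. a \<oplus> b \<otimes> r) as rs'"
  have v_eq: "v = a0 # map2 (\<lambda>a r. a \<oplus> b \<otimes> (y \<otimes> r)) as' rs"
    using carr by (simp add: v_def as rs'_def zip_map2 split_def)
  have zip_carr: "a \<in> carrier R" "t \<in> carrier R" if "(a, t) \<in> set (zip as' rs)" for a t
    using set_zip_leftD[OF that] set_zip_rightD[OF that] carr(3) rs(2) by auto
  then have v_carr: "set v \<subseteq> carrier R"
    using carr(1,2) rys(2) unfolding v_eq by auto
  define J where "J = Idl (set v)"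
  interpret J: ideal J R
    unfolding J_def by (rule genideal_ideal[OF v_carr])
  have "a \<oplus> b' \<otimes> t \<in> J" if "(a, t) \<in> set (zip as' rs)" for a t
  proof -
    note at = zip_carr[OF that]
    have "a \<oplus> b' \<otimes> t = (a \<oplus> b \<otimes> (y \<otimes> t)) \<oplus> (r \<otimes> t) \<otimes> a0"
      unfolding b'_def using at carr(1,2) rys(1,2) by algebra
    moreover have "a0 \<in> set v" "a \<oplus> b \<otimes> (y \<otimes> t) \<in> set v"
      using that unfolding v_eq by auto
    then have "a0 \<in> J" "a \<oplus> b \<otimes> (y \<otimes> t) \<in> J"
      using genideal_self[OF v_carr] unfolding J_def by blast+
    moreover have "r \<otimes> t \<in> carrier R"
      using at rys(1) by simp
    ultimately show ?thesis
      using J.a_closed J.I_l_closed by metis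
  qed
  then have "set (map2 (\<lambda>a r. a \<oplus> b' \<otimes> r) as' rs) \<subseteq> J"
    by auto
  then have "Idl (set (map2 (\<lambda>a r. a \<oplus> b' \<otimes> r) as' rs)) \<subseteq> J"
    by (rule genideal_minimal[OF J.is_ideal])
  moreover have "\<one> \<in> Idl (set (map2 (\<lambda>a r. a \<oplus> b' \<otimes> r) as' rs))"
    using um' unfolding Um_iff by blast
  ultimately have "\<one> \<in> Idl (set v)"
    unfolding J_def by blast
  moreover have "length v = Suc n"
    using rs(1) as(2) by (simp add: v_eq)
  ultimately have "v \<in> Um R (Suc n)"
    using v_carr unfolding Um_iff by blast
  moreover have "length rs' = Suc n" "set rs' \<subseteq> carrier R"
    using rs rys(2) by (auto simp: rs'_def)
  ultimately show "\<exists>rs. length rs = Suc n \<and> set rs \<subseteq> carrier R \<and>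
      map2 (\<lambda>a r. a \<oplus> b \<otimes> r) as rs \<in> Um R (Suc n)"
    unfolding v_def by blast
qed

text \<open>A finite \<open>sr\<close> excludes the empty set, whose infimum is \<infinity>. As
  \<open>enat\<close> is well-ordered, the infimum of a nonempty set is attained, and the condition
  climbs from the least value to n.\<close>

lemma sr_le_imp_stable_range_condition:
  assumes "sr R \<le> enat n"
  shows "stable_range_condition R n"
proof -
  define S where "S = {enat n | n. n \<ge> 1 \<and> stable_range_condition R n}"
  have sr: "sr R = Inf S"
    by (simp only: sr_def S_def)
  have "S \<noteq> {}"
    using assms by (auto simp: sr Inf_enat_def)
  then obtain k where "k \<in> S"
    by blast
  then have "sr R \<in> S"
    unfolding sr by (rule wellorder_InfI)
  then obtain m where m: "sr R = enat m" "stable_range_condition R m"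
    unfolding S_def by blast
  from m(1) assms have "m \<le> n"
    by simp
  then show ?thesis
    by (induction rule: dec_induct) (simp_all add: m(2) stable_range_condition_Suc)
qed

lemma sr_le_2_reduce:
  assumes "sr R \<le> 2" and "[a, b, d] \<in> Um R 3"
  obtains r s where "r \<in> carrier R" "s \<in> carrier R" "[a \<oplus> d \<otimes> r, b \<oplus> d \<otimes> s] \<in> Um R 2"
proof -
  have "stable_range_condition R 2"
    using assms(1) sr_le_imp_stable_range_condition[of 2] by (simp add: numeral_eq_enat)
  moreover have "[a, b] @ [d] \<in> Um R (2 + 1)"
    using assms(2) by simp
  ultimately obtain rs where rs: "length rs = 2" "set rs \<subseteq> carrier R"
    "map2 (\<lambda>a r. a \<oplus> d \<otimes> r) [a, b] rs \<in> Um R 2"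
    unfolding stable_range_condition_def by blast
  then obtain r s where "rs = [r, s]"
    by (auto simp: length_Suc_conv numeral_2_eq_2)
  with rs show ?thesis
    by (intro that[of r s]) simp_all
qed

lemma bilin_add_left:
  assumes "A \<in> mats R 2" "x1 \<in> carrier R" "x2 \<in> carrier R" "y1 \<in> carrier R" "y2 \<in> carrier R"
    "d \<in> carrier R" "u1 \<in> carrier R" "u2 \<in> carrier R"
  shows "bilin R A (x1 \<oplus> d \<otimes> u1) (x2 \<oplus> d \<otimes> u2) y1 y2 =
    bilin R A x1 x2 y1 y2 \<oplus> d \<otimes> bilin R A u1 u2 y1 y2"
  using assms unfolding bilin_def mats2_iff by algebra

lemma bilin_add_right:
  assumes "A \<in> mats R 2" "x1 \<in> carrier R" "x2 \<in> carrier R" "y1 \<in> carrier R" "y2 \<in> carrier R"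
    "d \<in> carrier R" "u1 \<in> carrier R" "u2 \<in> carrier R"
  shows "bilin R A x1 x2 (y1 \<oplus> d \<otimes> u1) (y2 \<oplus> d \<otimes> u2) =
    bilin R A x1 x2 y1 y2 \<oplus> d \<otimes> bilin R A x1 x2 u1 u2"
  using assms unfolding bilin_def mats2_iff by algebra

text \<open>The relation x^T A y + v D = 1 makes (x1, x2, D) unimodular, so x can be moved by
  multiples of D to a unimodular pair. This changes x^T A y by a multiple of D, which v absorbs. The
  same move is made for y with the new x, and then \<open>reduction_in_Um_mat2\<close>
  applies.\<close>

lemma sr_le_2_E2_imp_Z2:
  assumes sr: "sr R \<le> 2" and E2: "E2_ring R"
  shows "Z2_ring R"
  unfolding Z2_ring_def
proof
  fix A assume "A \<in> Um_mat2 R"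
  with E2 have A: "A \<in> mats R 2" "extendable R A"
    by (auto simp: E2_ring_def Um_mat2_def)
  define D where "D = det2 R A"
  have D: "D \<in> carrier R"
    using A(1) by (simp add: D_def)
  obtain x1 x2 y1 y2 v where x: "x1 \<in> carrier R" "x2 \<in> carrier R"
    and y: "y1 \<in> carrier R" "y2 \<in> carrier R" and v: "v \<in> carrier R"
    and eq: "bilin R A x1 x2 y1 y2 \<oplus> v \<otimes> D = \<one>"
    using A by (auto simp: extendable_iff D_def)
  have "(A 0 0 \<otimes> y1 \<oplus> A 0 1 \<otimes> y2) \<otimes> x1 \<oplus> ((A 1 0 \<otimes> y1 \<oplus> A 1 1 \<otimes> y2) \<otimes> x2 \<oplus> v \<otimes> D) =
      bilin R A x1 x2 y1 y2 \<oplus> v \<otimes> D"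
    using A(1) x y v D unfolding bilin_def mats2_iff by algebra
  then have "[x1, x2, D] \<in> Um R 3"
    using A(1) x y v D eq unfolding Um3_iff mats2_iff by (metis a_closed m_closed)
  then obtain r s where r: "r \<in> carrier R" "s \<in> carrier R"
    and um_x: "[x1 \<oplus> D \<otimes> r, x2 \<oplus> D \<otimes> s] \<in> Um R 2"
    using sr_le_2_reduce[OF sr] by metis
  define X1 X2 where "X1 = x1 \<oplus> D \<otimes> r" and "X2 = x2 \<oplus> D \<otimes> s"
  have X: "X1 \<in> carrier R" "X2 \<in> carrier R"
    using x r D by (simp_all add: X1_def X2_def)
  \<comment> \<open>The new corner coefficient takes up the change of the form caused by moving
    x.\<close>
  define w where "w = v \<ominus> bilin R A r s y1 y2"
  have w: "w \<in> carrier R"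
    using A r y v by (simp add: w_def)
  have eq_w: "bilin R A X1 X2 y1 y2 \<oplus> w \<otimes> D = \<one>"
  proof -
    have "b \<oplus> D \<otimes> c \<oplus> (v \<ominus> c) \<otimes> D = b \<oplus> v \<otimes> D" if "b \<in> carrier R" "c \<in> carrier R" for b c
      using that D v by algebra
    then show ?thesis
      using A x r y v D eq by (simp add: X1_def X2_def w_def bilin_add_left)
  qed
  \<comment> \<open>The relation for the new x is regrouped by y1 and y2, so that it shows (y1, y2,
    D) to be unimodular.\<close>
  have "(A 0 0 \<otimes> X1 \<oplus> A 1 0 \<otimes> X2) \<otimes> y1 \<oplus> ((A 0 1 \<otimes> X1 \<oplus> A 1 1 \<otimes> X2) \<otimes> y2 \<oplus> w \<otimes> D) =
      bilin R A X1 X2 y1 y2 \<oplus> w \<otimes> D"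
    using A(1) X y w D unfolding bilin_def mats2_iff by algebra
  then have "[y1, y2, D] \<in> Um R 3"
    using A(1) X y w D eq_w unfolding Um3_iff mats2_iff by (metis a_closed m_closed)
  then obtain t u where t: "t \<in> carrier R" "u \<in> carrier R"
    and um_y: "[y1 \<oplus> D \<otimes> t, y2 \<oplus> D \<otimes> u] \<in> Um R 2"
    using sr_le_2_reduce[OF sr] by metis
  define Y1 Y2 where "Y1 = y1 \<oplus> D \<otimes> t" and "Y2 = y2 \<oplus> D \<otimes> u"
  have Y: "Y1 \<in> carrier R" "Y2 \<in> carrier R"
    using y t D by (simp_all add: Y1_def Y2_def)
  define z where "z = w \<ominus> bilin R A X1 X2 t u"
  have z: "z \<in> carrier R"
    using A X t w by (simp add: z_def)
  have eq_z: "bilin R A X1 X2 Y1 Y2 \<oplus> z \<otimes> D = \<one>"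
  proof -
    have "b \<oplus> D \<otimes> c \<oplus> (w \<ominus> c) \<otimes> D = b \<oplus> w \<otimes> D" if "b \<in> carrier R" "c \<in> carrier R" for b c
      using that D w by algebra
    then show ?thesis
      using A X t y w D eq_w by (simp add: Y1_def Y2_def z_def bilin_add_right)
  qed
  have "reduction A X1 X2 Y1 Y2 \<in> Um_mat2 R"
    using A(1) z eq_z um_x um_y unfolding D_def X1_def X2_def Y1_def Y2_def
    by (intro reduction_in_Um_mat2)
  moreover have "cong_mat2 R (PIdl (det2 R A)) A (reduction A X1 X2 Y1 Y2)"
    using A(1) X Y z eq_z unfolding D_def by (intro cong_reduction)
  ultimately show "\<exists>B\<in>Um_mat2 R. cong_mat2 R (PIdl (det2 R A)) A B \<and> det2 R B = \<zero>"
    using det2_reduction[OF A(1) X Y] by blast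
qed

section \<open>Matrices of rank one\<close>

text \<open>B is p q^T, that is, of rank at most one: p and q may be zero, and no unimodularity is
  asked of them.\<close>

definition rank_one :: "(nat \<Rightarrow> nat \<Rightarrow> 'a) \<Rightarrow> 'a \<Rightarrow> 'a \<Rightarrow> 'a \<Rightarrow> 'a \<Rightarrow> bool" where
  "rank_one B p1 p2 q1 q2 \<longleftrightarrow>
    p1 \<in> carrier R \<and> p2 \<in> carrier R \<and> q1 \<in> carrier R \<and> q2 \<in> carrier R \<and>
    B 0 0 = p1 \<otimes> q1 \<and> B 0 1 = p1 \<otimes> q2 \<and> B 1 0 = p2 \<otimes> q1 \<and> B 1 1 = p2 \<otimes> q2"

lemma rank_one_in_mats: "rank_one B p1 p2 q1 q2 \<Longrightarrow> B \<in> mats R 2"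
  by (simp add: rank_one_def mats2_iff)

lemma bilin_rank_one:
  assumes "rank_one B p1 p2 q1 q2"
    "x1 \<in> carrier R" "x2 \<in> carrier R" "y1 \<in> carrier R" "y2 \<in> carrier R"
  shows "bilin R B x1 x2 y1 y2 = (x1 \<otimes> p1 \<oplus> x2 \<otimes> p2) \<otimes> (q1 \<otimes> y1 \<oplus> q2 \<otimes> y2)"
proof -
  have carr: "p1 \<in> carrier R" "p2 \<in> carrier R" "q1 \<in> carrier R" "q2 \<in> carrier R"
    and B: "B 0 0 = p1 \<otimes> q1" "B 0 1 = p1 \<otimes> q2" "B 1 0 = p2 \<otimes> q1" "B 1 1 = p2 \<otimes> q2"
    using assms(1) by (auto simp: rank_one_def)
  show ?thesis
    unfolding bilin_def B using carr assms(2-) by algebra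
qed

text \<open>These are the entries of (A y)(x^T A) = w A - D p q^T with w = x^T A y, D = det A, p =
  (-x2, x1) and q = (-y2, y1). So the matrix \<open>reduction\<close> is itself a column times a
  row, and for D = 0 and w = 1 the identity factors A.\<close>

lemma rank_one_factorization_identity:
  assumes "a \<in> carrier R" "b \<in> carrier R" "c \<in> carrier R" "d \<in> carrier R"
    "x1 \<in> carrier R" "x2 \<in> carrier R" "y1 \<in> carrier R" "y2 \<in> carrier R"
  shows "(a \<otimes> y1 \<oplus> b \<otimes> y2) \<otimes> (x1 \<otimes> a \<oplus> x2 \<otimes> c) =
      a \<otimes> (x1 \<otimes> (a \<otimes> y1 \<oplus> b \<otimes> y2) \<oplus> x2 \<otimes> (c \<otimes> y1 \<oplus> d \<otimes> y2)) \<ominus> (a \<otimes> d \<ominus> b \<otimes> c) \<otimes> (x2 \<otimes> y2)"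
    "(a \<otimes> y1 \<oplus> b \<otimes> y2) \<otimes> (x1 \<otimes> b \<oplus> x2 \<otimes> d) =
      b \<otimes> (x1 \<otimes> (a \<otimes> y1 \<oplus> b \<otimes> y2) \<oplus> x2 \<otimes> (c \<otimes> y1 \<oplus> d \<otimes> y2)) \<oplus> (a \<otimes> d \<ominus> b \<otimes> c) \<otimes> (x2 \<otimes> y1)"
    "(c \<otimes> y1 \<oplus> d \<otimes> y2) \<otimes> (x1 \<otimes> a \<oplus> x2 \<otimes> c) =
      c \<otimes> (x1 \<otimes> (a \<otimes> y1 \<oplus> b \<otimes> y2) \<oplus> x2 \<otimes> (c \<otimes> y1 \<oplus> d \<otimes> y2)) \<oplus> (a \<otimes> d \<ominus> b \<otimes> c) \<otimes> (x1 \<otimes> y2)"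
    "(c \<otimes> y1 \<oplus> d \<otimes> y2) \<otimes> (x1 \<otimes> b \<oplus> x2 \<otimes> d) =
      d \<otimes> (x1 \<otimes> (a \<otimes> y1 \<oplus> b \<otimes> y2) \<oplus> x2 \<otimes> (c \<otimes> y1 \<oplus> d \<otimes> y2)) \<ominus> (a \<otimes> d \<ominus> b \<otimes> c) \<otimes> (x1 \<otimes> y1)"
  using assms by algebra+

lemma det_zero_imp_rank_one:
  assumes B: "B \<in> mats R 2" "det2 R B = \<zero>"
    and xy: "x1 \<in> carrier R" "x2 \<in> carrier R" "y1 \<in> carrier R" "y2 \<in> carrier R"
    and one: "bilin R B x1 x2 y1 y2 = \<one>"
  obtains p1 p2 q1 q2 where "rank_one B p1 p2 q1 q2"
    "x1 \<otimes> p1 \<oplus> x2 \<otimes> p2 = \<one>" "q1 \<otimes> y1 \<oplus> q2 \<otimes> y2 = \<one>"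
proof -
  define p1 p2 q1 q2 where "p1 = B 0 0 \<otimes> y1 \<oplus> B 0 1 \<otimes> y2" and "p2 = B 1 0 \<otimes> y1 \<oplus> B 1 1 \<otimes> y2"
    and "q1 = x1 \<otimes> B 0 0 \<oplus> x2 \<otimes> B 1 0" and "q2 = x1 \<otimes> B 0 1 \<oplus> x2 \<otimes> B 1 1"
  note defs = this
  have B': "B 0 0 \<in> carrier R" "B 0 1 \<in> carrier R" "B 1 0 \<in> carrier R" "B 1 1 \<in> carrier R"
    using B by (simp_all add: mats2_iff)
  \<comment> \<open>Pairing p with x and q with y gives back the same value x^T B y, so both factors
    come with Bezout relations.\<close>
  have "x1 \<otimes> p1 \<oplus> x2 \<otimes> p2 = bilin R B x1 x2 y1 y2"
    by (simp add: bilin_def defs)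
  moreover have "q1 \<otimes> y1 \<oplus> q2 \<otimes> y2 = bilin R B x1 x2 y1 y2"
    unfolding bilin_def defs using B' xy by algebra
  moreover have "rank_one B p1 p2 q1 q2"
  proof -
    note id = rank_one_factorization_identity[OF B' xy, folded bilin_def det2_def, unfolded one B(2),
        folded defs]
    have "p1 \<in> carrier R" "p2 \<in> carrier R" "q1 \<in> carrier R" "q2 \<in> carrier R"
      using B' xy by (simp_all add: defs)
    moreover have "B 0 0 = p1 \<otimes> q1" "B 0 1 = p1 \<otimes> q2" "B 1 0 = p2 \<otimes> q1" "B 1 1 = p2 \<otimes> q2"
      unfolding id using B' xy by (simp_all add: a_minus_def)
    ultimately show ?thesis
      by (simp add: rank_one_def)
  qed
  ultimately show ?thesis
    using that one by simp
qed

text \<open>The extension supplied by the hypothesis on R is simple since det B = 0, and its border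
  provides the x and y from which B is factored.\<close>

lemma Pi2_det_zero_rank_one:
  assumes Pi2: "Pi2_ring R" and B: "B \<in> Um_mat2 R" "det2 R B = \<zero>"
  obtains p1 p2 q1 q2 x1 x2 y1 y2 where "rank_one B p1 p2 q1 q2"
    "x1 \<in> carrier R" "x2 \<in> carrier R" "y1 \<in> carrier R" "y2 \<in> carrier R"
    "x1 \<otimes> p1 \<oplus> x2 \<otimes> p2 = \<one>" "q1 \<otimes> y1 \<oplus> q2 \<otimes> y2 = \<one>"
proof -
  have B': "B \<in> mats R 2"
    using B by (simp add: Um_mat2_def)
  then have "simply_extendable R B"
    using Pi2 B by (auto simp: Pi2_ring_def intro: extendable_det_zero)
  then obtain x1 x2 y1 y2 where xy: "x1 \<in> carrier R" "x2 \<in> carrier R" "y1 \<in> carrier R"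
    "y2 \<in> carrier R" "bilin R B x1 x2 y1 y2 = \<one>"
    using simply_extendable_iff[OF B'] by auto
  show ?thesis
    by (rule det_zero_imp_rank_one[OF B' B(2) xy]) (rule that[OF _ xy(1-4)])
qed

lemma cong_mat2_decompose:
  assumes "cong_mat2 R (PIdl D) A B" "A \<in> mats R 2" "B \<in> mats R 2" "D \<in> carrier R"
  obtains N where "N \<in> mats R 2"
    "A 0 0 = B 0 0 \<oplus> D \<otimes> N 0 0" "A 0 1 = B 0 1 \<oplus> D \<otimes> N 0 1"
    "A 1 0 = B 1 0 \<oplus> D \<otimes> N 1 0" "A 1 1 = B 1 1 \<oplus> D \<otimes> N 1 1"
proof -
  have "\<exists>n. n \<in> carrier R \<and> A i j = B i j \<oplus> D \<otimes> n" if "i < 2" "j < 2" for i j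
  proof -
    have "A i j \<ominus> B i j \<in> PIdl D" "A i j \<in> carrier R" "B i j \<in> carrier R"
      using assms that by (simp_all add: cong_mat2_def mats_def)
    then show ?thesis
      using eq_add_of_minus_mem_PIdl assms(4) by metis
  qed
  then obtain N where "\<And>i j. i < 2 \<Longrightarrow> j < 2 \<Longrightarrow> N i j \<in> carrier R \<and> A i j = B i j \<oplus> D \<otimes> N i j"
    by metis
  then show ?thesis
    by (intro that[of N]) (auto simp: mats_def)
qed

lemma bilin_add_mat:
  assumes "B \<in> mats R 2" "N \<in> mats R 2" "D \<in> carrier R"
    "A 0 0 = B 0 0 \<oplus> D \<otimes> N 0 0" "A 0 1 = B 0 1 \<oplus> D \<otimes> N 0 1"
    "A 1 0 = B 1 0 \<oplus> D \<otimes> N 1 0" "A 1 1 = B 1 1 \<oplus> D \<otimes> N 1 1"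
    "x1 \<in> carrier R" "x2 \<in> carrier R" "y1 \<in> carrier R" "y2 \<in> carrier R"
  shows "bilin R A x1 x2 y1 y2 = bilin R B x1 x2 y1 y2 \<oplus> D \<otimes> bilin R N x1 x2 y1 y2"
  using assms(1-3,8-) unfolding bilin_def assms(4-7) mats2_iff by algebra

lemma bilin_linear_right:
  assumes "A \<in> mats R 2" "x1 \<in> carrier R" "x2 \<in> carrier R" "y1 \<in> carrier R" "y2 \<in> carrier R"
    "c \<in> carrier R" "d \<in> carrier R" "z1 \<in> carrier R" "z2 \<in> carrier R"
  shows "bilin R A x1 x2 (c \<otimes> y1 \<oplus> d \<otimes> z1) (c \<otimes> y2 \<oplus> d \<otimes> z2) =
    c \<otimes> bilin R A x1 x2 y1 y2 \<oplus> d \<otimes> bilin R A x1 x2 z1 z2"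
  using assms unfolding bilin_def mats2_iff by algebra

text \<open>
  In the bases \<open>x, (-p2, p1)\<close> and \<open>y, (-q2, q1)\<close> the matrix \<open>A\<close> becomes
  \<open>[[1 + D n1, D n2], [D n3, D n4]]\<close>, still of determinant \<open>D\<close>. Hence \<open>D e = 0\<close> for
  \<open>e = (1 + D n1) n4 - D n2 n3 - 1\<close>, and subtracting \<open>e\<close> from \<open>n4\<close> makes the first row
  take the value 1 even if \<open>D\<close> is a zero divisor.
\<close>

lemma simply_extendable_if_cong_rank_one:
  assumes A: "A \<in> mats R 2" and cong: "cong_mat2 R (PIdl (det2 R A)) A B"
    and B: "rank_one B p1 p2 q1 q2"
    and xy: "x1 \<in> carrier R" "x2 \<in> carrier R" "y1 \<in> carrier R" "y2 \<in> carrier R"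
    and xp: "x1 \<otimes> p1 \<oplus> x2 \<otimes> p2 = \<one>" and qy: "q1 \<otimes> y1 \<oplus> q2 \<otimes> y2 = \<one>"
  shows "simply_extendable R A"
proof -
  define D where "D = det2 R A"
  have D: "D \<in> carrier R"
    using A by (simp add: D_def)
  have pq: "p1 \<in> carrier R" "p2 \<in> carrier R" "q1 \<in> carrier R" "q2 \<in> carrier R"
    using B by (simp_all add: rank_one_def)
  have B': "B \<in> mats R 2"
    using B by (rule rank_one_in_mats)
  obtain N where N: "N \<in> mats R 2"
    "A 0 0 = B 0 0 \<oplus> D \<otimes> N 0 0" "A 0 1 = B 0 1 \<oplus> D \<otimes> N 0 1"
    "A 1 0 = B 1 0 \<oplus> D \<otimes> N 1 0" "A 1 1 = B 1 1 \<oplus> D \<otimes> N 1 1"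
    using cong_mat2_decompose[OF cong A B'] D by (auto simp: D_def)
  note bilin_A = bilin_add_mat[OF B' N(1) D N(2-5)]
  define n1 n2 n3 n4 where "n1 = bilin R N x1 x2 y1 y2" and "n2 = bilin R N x1 x2 (\<ominus> q2) q1"
    and "n3 = bilin R N (\<ominus> p2) p1 y1 y2" and "n4 = bilin R N (\<ominus> p2) p1 (\<ominus> q2) q1"
  have n: "n1 \<in> carrier R" "n2 \<in> carrier R" "n3 \<in> carrier R" "n4 \<in> carrier R"
    using N(1) xy pq by (simp_all add: n1_def n2_def n3_def n4_def)
  \<comment> \<open>The second basis vectors annihilate p and q, so B contributes only to the upper
    left entry of the transformed matrix.\<close>
  have pp: "\<ominus> p2 \<otimes> p1 \<oplus> p1 \<otimes> p2 = \<zero>" and qq: "q1 \<otimes> \<ominus> q2 \<oplus> q2 \<otimes> q1 = \<zero>"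
    using pq by algebra+
  have A1: "bilin R A x1 x2 y1 y2 = \<one> \<oplus> D \<otimes> n1"
    using bilin_A[OF xy] bilin_rank_one[OF B xy] xp qy by (simp add: n1_def)
  have A2: "bilin R A x1 x2 (\<ominus> q2) q1 = D \<otimes> n2"
    using bilin_A[of x1 x2 "\<ominus> q2" q1] bilin_rank_one[OF B, of x1 x2 "\<ominus> q2" q1] xy pq qq D n
    by (simp add: n2_def)
  have A3: "bilin R A (\<ominus> p2) p1 y1 y2 = D \<otimes> n3"
    using bilin_A[of "\<ominus> p2" p1 y1 y2] bilin_rank_one[OF B, of "\<ominus> p2" p1 y1 y2] xy pq pp D n
    by (simp add: n3_def)
  have A4: "bilin R A (\<ominus> p2) p1 (\<ominus> q2) q1 = D \<otimes> n4"
    using bilin_A[of "\<ominus> p2" p1 "\<ominus> q2" q1] bilin_rank_one[OF B, of "\<ominus> p2" p1 "\<ominus> q2" q1] pq pp D n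
    by (simp add: n4_def)
  define e where "e = (\<one> \<oplus> D \<otimes> n1) \<otimes> n4 \<ominus> D \<otimes> n2 \<otimes> n3 \<ominus> \<one>"
  have e: "e \<in> carrier R"
    using n D by (simp add: e_def)
  \<comment> \<open>By \<open>xp\<close> and \<open>qy\<close> both changes of basis have
    determinant 1, so \<open>cauchy_binet\<close> yields D again.\<close>
  have "D \<otimes> (x1 \<otimes> p1 \<ominus> x2 \<otimes> \<ominus> p2) \<otimes> (y1 \<otimes> q1 \<ominus> y2 \<otimes> \<ominus> q2) =
      D \<otimes> (x1 \<otimes> p1 \<oplus> x2 \<otimes> p2) \<otimes> (q1 \<otimes> y1 \<oplus> q2 \<otimes> y2)"
    using xy pq D by algebra
  then have "(\<one> \<oplus> D \<otimes> n1) \<otimes> (D \<otimes> n4) \<ominus> D \<otimes> n2 \<otimes> (D \<otimes> n3) = D"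
    using cauchy_binet[OF A xy(1,2) xy(3,4), of "\<ominus> p2" p1 "\<ominus> q2" q1] pq D xp qy
    by (simp add: A1 A2 A3 A4 flip: D_def)
  moreover have "D \<otimes> e = (\<one> \<oplus> D \<otimes> n1) \<otimes> (D \<otimes> n4) \<ominus> D \<otimes> n2 \<otimes> (D \<otimes> n3) \<ominus> D \<otimes> \<one>"
    unfolding e_def using n D by algebra
  ultimately have De: "D \<otimes> e = \<zero>"
    using D by (simp add: a_minus_def r_neg)
  \<comment> \<open>The coordinates in the basis y, (-q2, q1) are the second row without its factor
    D, turned by a quarter turn, with n4 lowered by e.\<close>
  define z1 z2 where "z1 = (n4 \<ominus> e) \<otimes> y1 \<oplus> (\<ominus> n3) \<otimes> (\<ominus> q2)"
    and "z2 = (n4 \<ominus> e) \<otimes> y2 \<oplus> (\<ominus> n3) \<otimes> q1"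
  have z: "z1 \<in> carrier R" "z2 \<in> carrier R"
    using xy pq n e by (simp_all add: z1_def z2_def)
  have "bilin R A x1 x2 z1 z2 = (n4 \<ominus> e) \<otimes> (\<one> \<oplus> D \<otimes> n1) \<oplus> (\<ominus> n3) \<otimes> (D \<otimes> n2)"
    using bilin_linear_right[OF A xy, of "n4 \<ominus> e" "\<ominus> n3" "\<ominus> q2" q1] pq n e
    unfolding z1_def z2_def by (simp only: A1 A2 minus_closed a_inv_closed)
  also have "\<dots> = ((\<one> \<oplus> D \<otimes> n1) \<otimes> n4 \<ominus> D \<otimes> n2 \<otimes> n3 \<ominus> \<one>) \<ominus> e \<ominus> (D \<otimes> e) \<otimes> n1 \<oplus> \<one>"
    using n e D by algebra
  also have "\<dots> = \<one>"
    using n e by (simp add: De a_minus_def r_neg flip: e_def[unfolded a_minus_def])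
  finally show ?thesis
    unfolding simply_extendable_iff[OF A] using xy(1,2) z by blast
qed

lemma Pi2_Z2_imp_SE2:
  assumes "Pi2_ring R" "Z2_ring R"
  shows "SE2_ring R"
  unfolding SE2_ring_def
proof
  fix A assume A: "A \<in> Um_mat2 R"
  then have A': "A \<in> mats R 2"
    by (simp add: Um_mat2_def)
  from A obtain B where B: "B \<in> Um_mat2 R" "det2 R B = \<zero>"
    and cong: "cong_mat2 R (PIdl (det2 R A)) A B"
    using assms(2) by (auto simp: Z2_ring_def)
  show "simply_extendable R A"
    by (rule Pi2_det_zero_rank_one[OF assms(1) B])
      (rule simply_extendable_if_cong_rank_one[OF A' cong])
qed

lemma extendable_if_cong_rank_one:
  assumes A: "A \<in> Um_mat2 R" and cong: "cong_mat2 R (PIdl (det2 R A)) A B"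
    and B: "rank_one B p1 p2 q1 q2"
  shows "extendable R A"
proof -
  define D where "D = det2 R A"
  have A': "A \<in> mats R 2"
    using A by (simp add: Um_mat2_def)
  have D: "D \<in> carrier R"
    using A' by (simp add: D_def)
  have pq: "p1 \<in> carrier R" "p2 \<in> carrier R" "q1 \<in> carrier R" "q2 \<in> carrier R"
    and B_eq: "B 0 0 = p1 \<otimes> q1" "B 0 1 = p1 \<otimes> q2" "B 1 0 = p2 \<otimes> q1" "B 1 1 = p2 \<otimes> q2"
    using B by (simp_all add: rank_one_def)
  have B': "B \<in> mats R 2"
    using B by (rule rank_one_in_mats)
  obtain N where N: "N \<in> mats R 2"
    "A 0 0 = B 0 0 \<oplus> D \<otimes> N 0 0" "A 0 1 = B 0 1 \<oplus> D \<otimes> N 0 1"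
    "A 1 0 = B 1 0 \<oplus> D \<otimes> N 1 0" "A 1 1 = B 1 1 \<oplus> D \<otimes> N 1 1"
    using cong_mat2_decompose[OF cong A' B'] D by (auto simp: D_def)
  obtain r s t u where rstu: "r \<in> carrier R" "s \<in> carrier R" "t \<in> carrier R" "u \<in> carrier R"
    and one: "r \<otimes> A 0 0 \<oplus> (s \<otimes> A 0 1 \<oplus> (t \<otimes> A 1 0 \<oplus> u \<otimes> A 1 1)) = \<one>"
    using A by (auto simp: Um_mat2_iff Um4_iff)
  define n where "n = r \<otimes> N 0 0 \<oplus> (s \<otimes> N 0 1 \<oplus> (t \<otimes> N 1 0 \<oplus> u \<otimes> N 1 1))"
  have n: "n \<in> carrier R"
    using N(1) rstu by (simp add: n_def mats2_iff)
  \<comment> \<open>Modulo D the unimodularity of A is a relation among the products p_i q_j.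
    Collecting it by p1 and p2 gives x, collecting it by q1 and q2 gives y, with the same error D n
    in both cases.\<close>
  define x1 x2 y1 y2 where "x1 = r \<otimes> q1 \<oplus> s \<otimes> q2" and "x2 = t \<otimes> q1 \<oplus> u \<otimes> q2"
    and "y1 = r \<otimes> p1 \<oplus> t \<otimes> p2" and "y2 = s \<otimes> p1 \<oplus> u \<otimes> p2"
  have xy: "x1 \<in> carrier R" "x2 \<in> carrier R" "y1 \<in> carrier R" "y2 \<in> carrier R"
    using rstu pq by (simp_all add: x1_def x2_def y1_def y2_def)
  have "r \<otimes> A 0 0 \<oplus> (s \<otimes> A 0 1 \<oplus> (t \<otimes> A 1 0 \<oplus> u \<otimes> A 1 1)) = (x1 \<otimes> p1 \<oplus> x2 \<otimes> p2) \<oplus> D \<otimes> n"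
    using N(1) rstu pq D unfolding N(2-5) B_eq x1_def x2_def n_def mats2_iff by algebra
  then have xp: "(x1 \<otimes> p1 \<oplus> x2 \<otimes> p2) = \<one> \<ominus> D \<otimes> n"
    using one xy pq D n by (metis a_closed m_closed add.inv_solve_right a_minus_def)
  have "r \<otimes> A 0 0 \<oplus> (s \<otimes> A 0 1 \<oplus> (t \<otimes> A 1 0 \<oplus> u \<otimes> A 1 1)) = (q1 \<otimes> y1 \<oplus> q2 \<otimes> y2) \<oplus> D \<otimes> n"
    using N(1) rstu pq D unfolding N(2-5) B_eq y1_def y2_def n_def mats2_iff by algebra
  then have qy: "(q1 \<otimes> y1 \<oplus> q2 \<otimes> y2) = \<one> \<ominus> D \<otimes> n"
    using one xy pq D n by (metis a_closed m_closed add.inv_solve_right a_minus_def)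
  define m where "m = bilin R N x1 x2 y1 y2"
  have m: "m \<in> carrier R"
    using N(1) xy by (simp add: m_def)
  have "bilin R A x1 x2 y1 y2 = (\<one> \<ominus> D \<otimes> n) \<otimes> (\<one> \<ominus> D \<otimes> n) \<oplus> D \<otimes> m"
    using bilin_add_mat[OF B' N(1) D N(2-5) xy] bilin_rank_one[OF B xy] xp qy by (simp add: m_def)
  \<comment> \<open>The coefficient of D cancels everything in (1 - D n)^2 + D m except 1.\<close>
  moreover have "(\<one> \<ominus> D \<otimes> n) \<otimes> (\<one> \<ominus> D \<otimes> n) \<oplus> D \<otimes> m \<oplus> (n \<oplus> n \<ominus> n \<otimes> D \<otimes> n \<ominus> m) \<otimes> D = \<one>"
    using n m D by algebra
  moreover have "n \<oplus> n \<ominus> n \<otimes> D \<otimes> n \<ominus> m \<in> carrier R"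
    using n m D by simp
  ultimately show ?thesis
    unfolding extendable_iff[OF A'] D_def[symmetric] using xy by metis
qed

end

text \<open>For nonzero a, primality splits a = f e along a d = b c with b = f m and c = e n.
  Cancelling a leaves d = n m, so p = (f, n) and q = (e, m).\<close>

lemma pre_schreier_rank_one:
  fixes D (structure)
  assumes D: "pre_schreier_domain D"
    and carr: "a \<in> carrier D" "b \<in> carrier D" "c \<in> carrier D" "d \<in> carrier D"
    and eq: "a \<otimes> d = b \<otimes> c"
  shows "\<exists>p1\<in>carrier D. \<exists>p2\<in>carrier D. \<exists>q1\<in>carrier D. \<exists>q2\<in>carrier D.
    a = p1 \<otimes> q1 \<and> b = p1 \<otimes> q2 \<and> c = p2 \<otimes> q1 \<and> d = p2 \<otimes> q2"
proof -
  interpret domain D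
    using D by (simp add: pre_schreier_domain_def)
  show ?thesis
  proof (cases "a = \<zero>")
    case True
    \<comment> \<open>Primality is given only for nonzero elements. When a = 0, the domain forces a
      zero first row or a zero first column, and either case factors directly.\<close>
    then have "b = \<zero> \<or> c = \<zero>"
      using eq carr integral by simp
    then show ?thesis
    proof
      assume "b = \<zero>"
      then show ?thesis
        using True carr by (intro bexI[of _ \<zero>] bexI[of _ \<one>] bexI[of _ c] bexI[of _ d]) simp_all
    next
      assume "c = \<zero>"
      then show ?thesis
        using True carr by (intro bexI[of _ b] bexI[of _ d] bexI[of _ \<zero>] bexI[of _ \<one>]) simp_all
    qed
  next
    case False
    then have "primal D a"
      using D carr by (simp add: pre_schreier_domain_def)
    moreover have "a divides\<^bsub>D\<^esub> b \<otimes> c"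
      using eq carr by (metis dividesI)
    ultimately obtain f e where fe: "f \<in> carrier D" "e \<in> carrier D" "a = f \<otimes> e"
      "f divides\<^bsub>D\<^esub> b" "e divides\<^bsub>D\<^esub> c"
      using carr unfolding primal_def by metis
    then obtain m n where mn: "m \<in> carrier D" "n \<in> carrier D" "b = f \<otimes> m" "c = e \<otimes> n"
      by (auto simp: factor_def)
    have "a \<otimes> d = a \<otimes> (n \<otimes> m)"
      unfolding eq unfolding mn fe(3) using fe(1,2) mn(1,2) by (simp add: m_ac)
    then have "d = n \<otimes> m"
      using False carr mn m_lcancel by simp
    moreover have "c = n \<otimes> e"
      using fe mn by (simp add: m_comm)
    ultimately show ?thesis
      using fe(1-3) mn(1-3) by blast
  qed
qed

context cring
begin

lemma det2_eq_zero_imp: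
  assumes "B \<in> mats R 2" and "det2 R B = \<zero>"
  shows "B 0 0 \<otimes> B 1 1 = B 0 1 \<otimes> B 1 0"
proof -
  have "B 0 0 \<otimes> B 1 1 = det2 R B \<oplus> B 0 1 \<otimes> B 1 0"
    using assms(1) unfolding det2_def mats2_iff by algebra
  then show ?thesis
    using assms by (simp add: mats2_iff)
qed

text \<open>The factors are chosen separately in each coordinate. Every family of elements is an
  element of the product, so the choices need no compatibility and I may be infinite;
  multiplicativity and bijectivity of h bring the factorization back to R.\<close>

lemma pre_schreier_product_rank_one:
  assumes D: "\<And>i. i \<in> I \<Longrightarrow> pre_schreier_domain (D i)" and iso: "R \<simeq> product_ring I D"
    and B: "B \<in> mats R 2" "det2 R B = \<zero>"
  obtains p1 p2 q1 q2 where "rank_one B p1 p2 q1 q2"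
proof -
  let ?P = "product_ring I D"
  obtain h where h: "h \<in> ring_iso R ?P"
    using iso by (auto simp: is_ring_iso_def)
  have bij: "bij_betw h (carrier R) (carrier ?P)"
    using ring_iso_memE(5)[OF h] .
  have mult: "h (x \<otimes> y) = (\<lambda>i\<in>I. h x i \<otimes>\<^bsub>D i\<^esub> h y i)"
    if "x \<in> carrier R" "y \<in> carrier R" for x y
    using ring_iso_memE(2)[OF h that] by (simp add: product_ring_def)
  have h_carr: "h x \<in> (\<Pi>\<^sub>E i\<in>I. carrier (D i))" if "x \<in> carrier R" for x
    using ring_iso_memE(1)[OF h that] by (simp add: product_ring_def)
  have B': "B 0 0 \<in> carrier R" "B 0 1 \<in> carrier R" "B 1 0 \<in> carrier R" "B 1 1 \<in> carrier R"
    using B(1) by (simp_all add: mats2_iff)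
  have "\<exists>p1\<in>carrier (D i). \<exists>p2\<in>carrier (D i). \<exists>q1\<in>carrier (D i). \<exists>q2\<in>carrier (D i).
      h (B 0 0) i = p1 \<otimes>\<^bsub>D i\<^esub> q1 \<and> h (B 0 1) i = p1 \<otimes>\<^bsub>D i\<^esub> q2 \<and>
      h (B 1 0) i = p2 \<otimes>\<^bsub>D i\<^esub> q1 \<and> h (B 1 1) i = p2 \<otimes>\<^bsub>D i\<^esub> q2" if i: "i \<in> I" for i
  proof (rule pre_schreier_rank_one[OF D[OF i]])
    \<comment> \<open>In the form a d = b c the vanishing determinant passes to coordinates by
      multiplicativity of h alone.\<close>
    have "h (B 0 0 \<otimes> B 1 1) = h (B 0 1 \<otimes> B 1 0)"
      using det2_eq_zero_imp[OF B] by simp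
    then have "(\<lambda>i\<in>I. h (B 0 0) i \<otimes>\<^bsub>D i\<^esub> h (B 1 1) i) i =
        (\<lambda>i\<in>I. h (B 0 1) i \<otimes>\<^bsub>D i\<^esub> h (B 1 0) i) i"
      using B' by (simp only: mult)
    then show "h (B 0 0) i \<otimes>\<^bsub>D i\<^esub> h (B 1 1) i = h (B 0 1) i \<otimes>\<^bsub>D i\<^esub> h (B 1 0) i"
      using i by simp
  qed (use B' h_carr i in \<open>auto dest: PiE_mem\<close>)
  then obtain P1 P2 Q1 Q2 where P: "\<And>i. i \<in> I \<Longrightarrow>
      P1 i \<in> carrier (D i) \<and> P2 i \<in> carrier (D i) \<and> Q1 i \<in> carrier (D i) \<and> Q2 i \<in> carrier (D i) \<and>
      h (B 0 0) i = P1 i \<otimes>\<^bsub>D i\<^esub> Q1 i \<and> h (B 0 1) i = P1 i \<otimes>\<^bsub>D i\<^esub> Q2 i \<and>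
      h (B 1 0) i = P2 i \<otimes>\<^bsub>D i\<^esub> Q1 i \<and> h (B 1 1) i = P2 i \<otimes>\<^bsub>D i\<^esub> Q2 i"
    by metis
  have lift: "\<exists>x\<in>carrier R. h x = restrict F I" if "\<And>i. i \<in> I \<Longrightarrow> F i \<in> carrier (D i)" for F
  proof -
    have "restrict F I \<in> carrier ?P"
      using that by (simp add: product_ring_def)
    then show ?thesis
      using bij unfolding bij_betw_def by (metis imageE)
  qed
  obtain p1 p2 q1 q2 where pq: "p1 \<in> carrier R" "h p1 = restrict P1 I"
    "p2 \<in> carrier R" "h p2 = restrict P2 I" "q1 \<in> carrier R" "h q1 = restrict Q1 I"
    "q2 \<in> carrier R" "h q2 = restrict Q2 I"
    using lift[of P1] lift[of P2] lift[of Q1] lift[of Q2] P by blast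
  have eqI: "x = p \<otimes> q" if x: "x \<in> carrier R" and p: "p \<in> carrier R" "h p = restrict F I"
    and q: "q \<in> carrier R" "h q = restrict G I" and xi: "\<And>i. i \<in> I \<Longrightarrow> h x i = F i \<otimes>\<^bsub>D i\<^esub> G i"
    for x p q F G
  proof -
    have "h x i = h (p \<otimes> q) i" for i
    proof (cases "i \<in> I")
      case True
      then show ?thesis
        using p q xi by (simp add: mult)
    next
      \<comment> \<open>Elements of the extensional product take the value \<open>undefined\<close>
        outside I, so the two sides agree there as well.\<close>
      case False
      then show ?thesis
        using PiE_arb[OF h_carr[OF x]] PiE_arb[OF h_carr[of "p \<otimes> q"]] p q by simp
    qed
    then have "h x = h (p \<otimes> q)"
      by blast
    then show ?thesis
      using bij x p q unfolding bij_betw_def by (meson inj_onD m_closed)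
  qed
  have "B 0 0 = p1 \<otimes> q1" "B 0 1 = p1 \<otimes> q2" "B 1 0 = p2 \<otimes> q1" "B 1 1 = p2 \<otimes> q2"
    using B' pq P by (auto intro!: eqI)
  with pq show ?thesis
    by (intro that[of p1 p2 q1 q2]) (simp add: rank_one_def)
qed

lemma pre_schreier_product_WZ2_imp_E2:
  assumes D: "\<And>i. i \<in> I \<Longrightarrow> pre_schreier_domain (D i)" and iso: "R \<simeq> product_ring I D"
    and WZ2: "WZ2_ring R"
  shows "E2_ring R"
  unfolding E2_ring_def
proof
  fix A assume A: "A \<in> Um_mat2 R"
  then obtain B where B: "B \<in> mats R 2" "det2 R B = \<zero>"
    and cong: "cong_mat2 R (PIdl (det2 R A)) A B"
    using WZ2 by (auto simp: WZ2_ring_def)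
  show "extendable R A"
    by (rule pre_schreier_product_rank_one[OF _ iso B])
      (erule D, rule extendable_if_cong_rank_one[OF A cong])
qed

section \<open>Triangular matrices and the V_2 condition\<close>

lemma Um_triangular_mat2:
  assumes "[a, b, c] \<in> Um R 3"
  shows "mat2 a b \<zero> c \<in> Um_mat2 R"
proof -
  have "[a, b, \<zero>, c] \<in> Um R 4"
  proof -
    obtain r s t where "r \<in> carrier R" "s \<in> carrier R" "t \<in> carrier R" "a \<in> carrier R"
      "b \<in> carrier R" "c \<in> carrier R" "r \<otimes> a \<oplus> (s \<otimes> b \<oplus> t \<otimes> c) = \<one>"
      using assms by (auto simp: Um3_iff)
    moreover from this have "r \<otimes> a \<oplus> (s \<otimes> b \<oplus> (\<zero> \<otimes> \<zero> \<oplus> t \<otimes> c)) = \<one>"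
      by simp
    ultimately show ?thesis
      unfolding Um4_iff by blast
  qed
  then show ?thesis
    using assms by (simp add: Um_mat2_iff Um3_iff)
qed

text \<open>In the form attached to the triangular matrix with rows (a, b) and (0, c), the product
  x2 y1 meets the zero entry, so three terms remain.\<close>

lemma SE2_triangle_Um3:
  assumes SE2: "SE2_triangle_ring R" and um: "[a, b, c] \<in> Um R 3"
  obtains x1 x2 y1 y2 where "x1 \<in> carrier R" "x2 \<in> carrier R" "y1 \<in> carrier R" "y2 \<in> carrier R"
    "a \<otimes> (x1 \<otimes> y1) \<oplus> b \<otimes> (x1 \<otimes> y2) \<oplus> c \<otimes> (x2 \<otimes> y2) = \<one>"
proof -
  have carr: "a \<in> carrier R" "b \<in> carrier R" "c \<in> carrier R"
    using um by (auto simp: Um3_iff)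
  have A: "mat2 a b \<zero> c \<in> mats R 2"
    using carr by simp
  have "simply_extendable R (mat2 a b \<zero> c)"
    using SE2 Um_triangular_mat2[OF um] by (simp add: SE2_triangle_ring_def)
  then obtain x1 x2 y1 y2 where xy: "x1 \<in> carrier R" "x2 \<in> carrier R" "y1 \<in> carrier R"
    "y2 \<in> carrier R" and eq: "x1 \<otimes> (a \<otimes> y1 \<oplus> b \<otimes> y2) \<oplus> x2 \<otimes> (\<zero> \<otimes> y1 \<oplus> c \<otimes> y2) = \<one>"
    using simply_extendable_iff[OF A] by auto
  have "a \<otimes> (x1 \<otimes> y1) \<oplus> b \<otimes> (x1 \<otimes> y2) \<oplus> c \<otimes> (x2 \<otimes> y2) =
      x1 \<otimes> (a \<otimes> y1 \<oplus> b \<otimes> y2) \<oplus> x2 \<otimes> (\<zero> \<otimes> y1 \<oplus> c \<otimes> y2)"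
    using carr xy by algebra
  with xy eq that show ?thesis
    by simp
qed

text \<open>The four products of an x with a y form a singular matrix, whence x w = y z. The other
  equation rearranges a x + b y + c w = 1: both sides equal b y + a c y z.\<close>

lemma SE2_triangle_imp_V2:
  assumes "SE2_triangle_ring R" shows "V2_ring R"
  unfolding V2_ring_def
proof (intro allI impI)
  fix a b c assume um: "[a, b, c] \<in> Um R 3"
  then have carr: "a \<in> carrier R" "b \<in> carrier R" "c \<in> carrier R"
    by (auto simp: Um3_iff)
  obtain x1 x2 y1 y2 where xy: "x1 \<in> carrier R" "x2 \<in> carrier R" "y1 \<in> carrier R"
    "y2 \<in> carrier R" and eq: "a \<otimes> (x1 \<otimes> y1) \<oplus> b \<otimes> (x1 \<otimes> y2) \<oplus> c \<otimes> (x2 \<otimes> y2) = \<one>"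
    using SE2_triangle_Um3[OF assms um] .
  define x y z w where "x = x1 \<otimes> y1" and "y = x1 \<otimes> y2" and "z = x2 \<otimes> y1" and "w = x2 \<otimes> y2"
  have xyzw: "x \<in> carrier R" "y \<in> carrier R" "z \<in> carrier R" "w \<in> carrier R"
    using xy by (simp_all add: x_def y_def z_def w_def)
  have xw: "x \<otimes> w = y \<otimes> z"
    using xy by (simp add: x_def y_def z_def w_def m_ac)
  have "y \<otimes> (b \<oplus> a \<otimes> c \<otimes> z) =
      (a \<otimes> x \<oplus> b \<otimes> y \<oplus> c \<otimes> w) \<ominus> a \<otimes> x \<ominus> c \<otimes> w \<oplus> a \<otimes> c \<otimes> (y \<otimes> z)"
    using carr xyzw by algebra
  also have "\<dots> = \<one> \<ominus> a \<otimes> x \<ominus> c \<otimes> w \<oplus> a \<otimes> c \<otimes> (x \<otimes> w)"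
    using eq xw by (simp add: x_def y_def w_def)
  also have "\<dots> = (\<one> \<ominus> a \<otimes> x) \<otimes> (\<one> \<ominus> c \<otimes> w)"
    using carr xyzw by algebra
  finally show "\<exists>x\<in>carrier R. \<exists>y\<in>carrier R. \<exists>z\<in>carrier R. \<exists>w\<in>carrier R.
      (\<one> \<ominus> a \<otimes> x) \<otimes> (\<one> \<ominus> c \<otimes> w) = y \<otimes> (b \<oplus> a \<otimes> c \<otimes> z) \<and> x \<otimes> w = y \<otimes> z"
    using xyzw xw by metis
qed

section \<open>Units of quotients\<close>

lemma Um2I:
  assumes "r \<otimes> a \<oplus> s \<otimes> b = \<one>"
    "r \<in> carrier R" "s \<in> carrier R" "a \<in> carrier R" "b \<in> carrier R"
  shows "[a, b] \<in> Um R 2"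
  using assms unfolding Um2_iff by blast

lemma PIdl_quot_simps:
  assumes "m \<in> carrier R" "x \<in> carrier R" "y \<in> carrier R"
  shows "(PIdl m +> x) \<otimes>\<^bsub>R Quot PIdl m\<^esub> (PIdl m +> y) = PIdl m +> (x \<otimes> y)"
    "PIdl m +> x \<in> carrier (R Quot PIdl m)"
  using ring_hom_mult[OF ideal.rcos_ring_hom[OF cgenideal_ideal[OF assms(1)]] assms(2,3)]
    ring_hom_closed[OF ideal.rcos_ring_hom[OF cgenideal_ideal[OF assms(1)]] assms(2)]
  by simp_all

lemma quot_carrierE:
  assumes "X \<in> carrier (R Quot J)"
  obtains x where "x \<in> carrier R" "X = J +> x"
  using assms by (auto simp: FactRing_def A_RCOSETS_def')

lemma Um2_PIdl_iff:
  assumes "u \<in> carrier R" "m \<in> carrier R"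
  shows "[u, m] \<in> Um R 2 \<longleftrightarrow> (\<exists>v\<in>carrier R. PIdl m +> (u \<otimes> v) = PIdl m +> \<one>)"
proof -
  have "PIdl m +> (u \<otimes> v) = PIdl m +> \<one> \<longleftrightarrow> (\<exists>s\<in>carrier R. v \<otimes> u \<oplus> s \<otimes> m = \<one>)"
    if v: "v \<in> carrier R" for v
  proof -
    have "PIdl m +> (u \<otimes> v) = PIdl m +> \<one> \<longleftrightarrow> u \<otimes> v \<ominus> \<one> \<in> PIdl m"
      using assms v by (simp add: quotient_eq_iff_same_a_r_cos cgenideal_ideal)
    also have "\<dots> \<longleftrightarrow> (\<exists>s\<in>carrier R. v \<otimes> u \<oplus> s \<otimes> m = \<one>)"
    proof
      assume "u \<otimes> v \<ominus> \<one> \<in> PIdl m"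
      then obtain s where s: "s \<in> carrier R" "u \<otimes> v \<ominus> \<one> = s \<otimes> m"
        by (auto simp: cgenideal_def)
      have "v \<otimes> u \<oplus> (\<ominus> s) \<otimes> m = v \<otimes> u \<ominus> s \<otimes> m"
        using assms v s(1) by algebra
      also have "\<dots> = \<one>"
        unfolding s(2)[symmetric] using assms v by algebra
      finally show "\<exists>s\<in>carrier R. v \<otimes> u \<oplus> s \<otimes> m = \<one>"
        using s(1) by blast
    next
      assume "\<exists>s\<in>carrier R. v \<otimes> u \<oplus> s \<otimes> m = \<one>"
      then obtain s where s: "s \<in> carrier R" "v \<otimes> u \<oplus> s \<otimes> m = \<one>"
        by blast
      have "u \<otimes> v \<ominus> (v \<otimes> u \<oplus> s \<otimes> m) = (\<ominus> s) \<otimes> m"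
        using assms v s(1) by algebra
      then show "u \<otimes> v \<ominus> \<one> \<in> PIdl m"
        using s by (auto simp: cgenideal_def)
    qed
    finally show ?thesis .
  qed
  then show ?thesis
    using assms by (auto simp: Um2_iff)
qed

text \<open>This replaces units of quotients by Bezout relations in R, so the arguments about U_2
  can be carried out on representatives.\<close>

lemma Units_quot_PIdl_iff:
  assumes m: "m \<in> carrier R"
  shows "X \<in> Units (R Quot PIdl m) \<longleftrightarrow> (\<exists>u. [u, m] \<in> Um R 2 \<and> X = PIdl m +> u)"
proof -
  interpret Q: cring "R Quot PIdl m"
    using ideal.quotient_is_cring[OF cgenideal_ideal[OF m] is_cring] .
  have one: "\<one>\<^bsub>R Quot PIdl m\<^esub> = PIdl m +> \<one>"
    by (simp add: FactRing_def)
  show ?thesis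
  proof
    assume "X \<in> Units (R Quot PIdl m)"
    then obtain Y where "X \<in> carrier (R Quot PIdl m)" "Y \<in> carrier (R Quot PIdl m)"
      "X \<otimes>\<^bsub>R Quot PIdl m\<^esub> Y = \<one>\<^bsub>R Quot PIdl m\<^esub>"
      by (auto simp: Units_def)
    then obtain u v where "u \<in> carrier R" "X = PIdl m +> u" "v \<in> carrier R"
      "PIdl m +> (u \<otimes> v) = PIdl m +> \<one>"
      using m one by (auto elim!: quot_carrierE simp: PIdl_quot_simps)
    moreover from this have "[u, m] \<in> Um R 2"
      using m by (auto simp: Um2_PIdl_iff)
    ultimately show "\<exists>u. [u, m] \<in> Um R 2 \<and> X = PIdl m +> u"
      by blast
  next
    assume "\<exists>u. [u, m] \<in> Um R 2 \<and> X = PIdl m +> u"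
    then obtain u where um: "[u, m] \<in> Um R 2" and X: "X = PIdl m +> u"
      by blast
    have u: "u \<in> carrier R"
      using um by (simp add: Um2_iff)
    obtain v where v: "v \<in> carrier R" "PIdl m +> (u \<otimes> v) = PIdl m +> \<one>"
      using um Um2_PIdl_iff[OF u m] by blast
    have "(PIdl m +> u) \<otimes>\<^bsub>R Quot PIdl m\<^esub> (PIdl m +> v) = \<one>\<^bsub>R Quot PIdl m\<^esub>"
      using m u v one by (simp add: PIdl_quot_simps)
    moreover have "(PIdl m +> v) \<otimes>\<^bsub>R Quot PIdl m\<^esub> (PIdl m +> u) = \<one>\<^bsub>R Quot PIdl m\<^esub>"
      using m u v one by (simp add: PIdl_quot_simps m_comm)
    ultimately show "X \<in> Units (R Quot PIdl m)"
      unfolding Units_def X using m u v(1) PIdl_quot_simps(2) by blast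
  qed
qed

lemma Um2_mult:
  assumes "[u, m] \<in> Um R 2" "[v, m] \<in> Um R 2"
  shows "[u \<otimes> v, m] \<in> Um R 2"
proof -
  obtain r s where r: "u \<in> carrier R" "m \<in> carrier R" "r \<in> carrier R" "s \<in> carrier R"
    "r \<otimes> u \<oplus> s \<otimes> m = \<one>"
    using assms(1) by (auto simp: Um2_iff)
  obtain t w where t: "v \<in> carrier R" "t \<in> carrier R" "w \<in> carrier R" "t \<otimes> v \<oplus> w \<otimes> m = \<one>"
    using assms(2) by (auto simp: Um2_iff)
  have "(r \<otimes> t) \<otimes> (u \<otimes> v) \<oplus> (r \<otimes> u \<otimes> w \<oplus> s \<otimes> (t \<otimes> v \<oplus> w \<otimes> m)) \<otimes> m =
      (r \<otimes> u \<oplus> s \<otimes> m) \<otimes> (t \<otimes> v \<oplus> w \<otimes> m)"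
    using r(1-4) t(1-3) by algebra
  also have "\<dots> = \<one>"
    using r t by simp
  finally show ?thesis
    by (rule Um2I) (use r(1-4) t(1-3) in simp_all)
qed

text \<open>One relation serves several purposes: it exhibits r as an inverse of u modulo a c, so r
  is a unit there too, and it reduces to a relation modulo c.\<close>

lemma Um2_factor:
  assumes "r \<otimes> u \<oplus> s \<otimes> (a \<otimes> c) = \<one>" "r \<in> carrier R" "u \<in> carrier R" "s \<in> carrier R"
    "a \<in> carrier R" "c \<in> carrier R"
  shows "[u, a \<otimes> c] \<in> Um R 2" "[r, a \<otimes> c] \<in> Um R 2" "[u, c] \<in> Um R 2"
proof -
  show "[u, a \<otimes> c] \<in> Um R 2"
    using assms(1) by (rule Um2I) (use assms in simp_all)
  have "u \<otimes> r \<oplus> s \<otimes> (a \<otimes> c) = \<one>"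
    using assms by (simp add: m_comm)
  then show "[r, a \<otimes> c] \<in> Um R 2"
    by (rule Um2I) (use assms in simp_all)
  have "r \<otimes> u \<oplus> (s \<otimes> a) \<otimes> c = \<one>"
    using assms by (simp add: m_assoc)
  then show "[u, c] \<in> Um R 2"
    by (rule Um2I) (use assms in simp_all)
qed

lemma Um2_divisor:
  assumes "[u, a \<otimes> c] \<in> Um R 2" "a \<in> carrier R" "c \<in> carrier R"
  shows "[u, c] \<in> Um R 2"
proof -
  obtain r s where r: "r \<in> carrier R" "u \<in> carrier R" "s \<in> carrier R"
    "r \<otimes> u \<oplus> s \<otimes> (a \<otimes> c) = \<one>"
    using assms(1) by (auto simp: Um2_iff)
  show ?thesis
    using Um2_factor(3)[OF r(4,1-3) assms(2,3)] .
qed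

lemma PIdl_mult_subset:
  assumes "a \<in> carrier R" "c \<in> carrier R"
  shows "PIdl (a \<otimes> c) \<subseteq> PIdl c"
  using assms by (intro cgenideal_minimal cgenideal_ideal) (auto simp: cgenideal_def)

lemma unit_product_hom_rcos:
  assumes "a \<in> carrier R" "b \<in> carrier R" "c \<in> carrier R" "s \<in> carrier R" "t \<in> carrier R"
  shows "unit_product_hom R c (PIdl (a \<otimes> c) +> s, PIdl (b \<otimes> c) +> t) = PIdl c +> (s \<otimes> t)"
  using assms
  by (simp add: unit_product_hom_def coset_reduction cgenideal_ideal PIdl_mult_subset
      PIdl_quot_simps)

text \<open>The two parenthesized factors on the left are 1 modulo c, so the left side is d modulo
  c. The explicit cofactor of c is what the congruence proof consumes.\<close>

lemma lifting_correction_identity: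
  assumes "a \<in> carrier R" "b \<in> carrier R" "c \<in> carrier R" "d \<in> carrier R" "k \<in> carrier R"
    "f \<in> carrier R" "g \<in> carrier R" "m \<in> carrier R" "n \<in> carrier R"
  shows "d \<otimes> (\<one> \<ominus> f \<otimes> (a \<otimes> c)) \<otimes> (\<one> \<ominus> g \<otimes> (b \<otimes> c)) \<oplus> k \<otimes> c \<otimes> (m \<otimes> n) =
    d \<oplus> c \<otimes> (k \<otimes> (m \<otimes> n) \<ominus> d \<otimes> f \<otimes> a \<ominus> d \<otimes> g \<otimes> b \<oplus> d \<otimes> f \<otimes> a \<otimes> (g \<otimes> (b \<otimes> c)))"
  using assms by algebra

text \<open>It suffices to write \<open>d\<close> modulo \<open>c\<close> as the product of the fractions \<open>s2/s1\<close> and \<open>t2/t1\<close>.\<close>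

lemma U2_ringI:
  assumes fractions: "\<And>a b c d. [a, b] \<in> Um R 2 \<Longrightarrow> c \<in> carrier R \<Longrightarrow> [d, c] \<in> Um R 2 \<Longrightarrow>
    \<exists>s1 s2 t1 t2. \<exists>k\<in>carrier R. [s1, a \<otimes> c] \<in> Um R 2 \<and> [s2, a \<otimes> c] \<in> Um R 2 \<and>
      [t1, b \<otimes> c] \<in> Um R 2 \<and> [t2, b \<otimes> c] \<in> Um R 2 \<and> s1 \<otimes> t1 \<otimes> d \<oplus> k \<otimes> c = s2 \<otimes> t2"
  shows "U2_ring R"
  unfolding U2_ring_def
proof (intro allI impI equalityI subsetI)
  fix a b c X
  assume ab: "[a, b] \<in> Um R 2" and c: "c \<in> carrier R"
  have carr: "a \<in> carrier R" "b \<in> carrier R"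
    using ab by (auto simp: Um2_iff)
  {
    \<comment> \<open>The condition is an equality of sets, so products of units have to be shown to
      be units modulo c as well.\<close>
    assume "X \<in> unit_product_hom R c `
      (Units (R Quot PIdl (a \<otimes> c)) \<times> Units (R Quot PIdl (b \<otimes> c)))"
    then obtain s t where st: "[s, a \<otimes> c] \<in> Um R 2" "[t, b \<otimes> c] \<in> Um R 2"
      and X: "X = unit_product_hom R c (PIdl (a \<otimes> c) +> s, PIdl (b \<otimes> c) +> t)"
      using carr c by (auto simp: Units_quot_PIdl_iff)
    have "[s \<otimes> t, c] \<in> Um R 2"
      using st carr c by (intro Um2_mult) (auto intro: Um2_divisor)
    moreover have "X = PIdl c +> (s \<otimes> t)"
      using X carr c st by (simp add: unit_product_hom_rcos Um2_iff)
    ultimately show "X \<in> Units (R Quot PIdl c)"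
      using c by (auto simp: Units_quot_PIdl_iff)
  }
  assume "X \<in> Units (R Quot PIdl c)"
  then obtain d where d: "[d, c] \<in> Um R 2" and X: "X = PIdl c +> d"
    using c by (auto simp: Units_quot_PIdl_iff)
  obtain s1 s2 t1 t2 k where k: "k \<in> carrier R" and um: "[s1, a \<otimes> c] \<in> Um R 2"
    "[s2, a \<otimes> c] \<in> Um R 2" "[t1, b \<otimes> c] \<in> Um R 2" "[t2, b \<otimes> c] \<in> Um R 2"
    and eq: "s1 \<otimes> t1 \<otimes> d \<oplus> k \<otimes> c = s2 \<otimes> t2"
    using fractions[OF ab c d] by blast
  have st: "s1 \<in> carrier R" "s2 \<in> carrier R" "t1 \<in> carrier R" "t2 \<in> carrier R" "d \<in> carrier R"
    using um d by (simp_all add: Um2_iff)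
  \<comment> \<open>m inverts s1 modulo a c and n inverts t1 modulo b c, so m s2 and n t2 represent
    the two fractions.\<close>
  obtain m f where m: "m \<in> carrier R" "f \<in> carrier R" "m \<otimes> s1 \<oplus> f \<otimes> (a \<otimes> c) = \<one>"
    using um(1) by (auto simp: Um2_iff)
  obtain n g where n: "n \<in> carrier R" "g \<in> carrier R" "n \<otimes> t1 \<oplus> g \<otimes> (b \<otimes> c) = \<one>"
    using um(3) by (auto simp: Um2_iff)
  have ms: "m \<otimes> s1 = \<one> \<ominus> f \<otimes> (a \<otimes> c)"
  proof -
    have "m \<otimes> s1 = (m \<otimes> s1 \<oplus> f \<otimes> (a \<otimes> c)) \<ominus> f \<otimes> (a \<otimes> c)"
      using m(1,2) st carr c by algebra
    then show ?thesis
      by (simp only: m(3))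
  qed
  have nt: "n \<otimes> t1 = \<one> \<ominus> g \<otimes> (b \<otimes> c)"
  proof -
    have "n \<otimes> t1 = (n \<otimes> t1 \<oplus> g \<otimes> (b \<otimes> c)) \<ominus> g \<otimes> (b \<otimes> c)"
      using n(1,2) st carr c by algebra
    then show ?thesis
      by (simp only: n(3))
  qed
  have um_s: "[m \<otimes> s2, a \<otimes> c] \<in> Um R 2"
    using Um2_factor(2)[OF m(3,1) st(1) m(2) carr(1) c] um(2) by (rule Um2_mult)
  have um_t: "[n \<otimes> t2, b \<otimes> c] \<in> Um R 2"
    using Um2_factor(2)[OF n(3,1) st(3) n(2) carr(2) c] um(4) by (rule Um2_mult)
  have "(m \<otimes> s2) \<otimes> (n \<otimes> t2) = (m \<otimes> n) \<otimes> (s2 \<otimes> t2)"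
    using m n st by (simp add: m_ac)
  also have "\<dots> = (m \<otimes> n) \<otimes> (s1 \<otimes> t1 \<otimes> d \<oplus> k \<otimes> c)"
    by (simp only: eq)
  also have "\<dots> = d \<otimes> (m \<otimes> s1) \<otimes> (n \<otimes> t1) \<oplus> k \<otimes> c \<otimes> (m \<otimes> n)"
    using m(1) n(1) st k c by algebra
  also have "\<dots> = d \<oplus> c \<otimes> (k \<otimes> (m \<otimes> n) \<ominus> d \<otimes> f \<otimes> a \<ominus> d \<otimes> g \<otimes> b \<oplus> d \<otimes> f \<otimes> a \<otimes> (g \<otimes> (b \<otimes> c)))"
    unfolding ms nt using carr c st k m n by (intro lifting_correction_identity)
  finally have "(m \<otimes> s2) \<otimes> (n \<otimes> t2) \<ominus> d \<in> PIdl c"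
    by (rule minus_mem_PIdlI) (use carr c st k m n in simp_all)
  then have "PIdl c +> ((m \<otimes> s2) \<otimes> (n \<otimes> t2)) = X"
    using c m n st X quotient_eq_iff_same_a_r_cos[OF cgenideal_ideal[OF c]] by simp
  then have "X = unit_product_hom R c (PIdl (a \<otimes> c) +> (m \<otimes> s2), PIdl (b \<otimes> c) +> (n \<otimes> t2))"
    using carr c m n st by (simp add: unit_product_hom_rcos)
  moreover have "PIdl (a \<otimes> c) +> (m \<otimes> s2) \<in> Units (R Quot PIdl (a \<otimes> c))"
    "PIdl (b \<otimes> c) +> (n \<otimes> t2) \<in> Units (R Quot PIdl (b \<otimes> c))"
    using um_s um_t carr c by (auto simp: Units_quot_PIdl_iff)
  ultimately show "X \<in> unit_product_hom R c `
      (Units (R Quot PIdl (a \<otimes> c)) \<times> Units (R Quot PIdl (b \<otimes> c)))"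
    by blast
qed

text \<open>Since a and b generate the unit ideal, a c and b c together generate the same ideal as
  c, and d is a unit modulo c.\<close>

lemma Um3_conductor:
  assumes ab: "[a, b] \<in> Um R 2" and dc: "[d, c] \<in> Um R 2"
  shows "[a \<otimes> c, d, b \<otimes> c] \<in> Um R 3"
proof -
  obtain x y where x: "a \<in> carrier R" "b \<in> carrier R" "x \<in> carrier R" "y \<in> carrier R"
    "x \<otimes> a \<oplus> y \<otimes> b = \<one>"
    using ab by (auto simp: Um2_iff)
  obtain r s where r: "d \<in> carrier R" "c \<in> carrier R" "r \<in> carrier R" "s \<in> carrier R"
    "r \<otimes> d \<oplus> s \<otimes> c = \<one>"
    using dc by (auto simp: Um2_iff)
  have "(s \<otimes> x) \<otimes> (a \<otimes> c) \<oplus> (r \<otimes> d \<oplus> (s \<otimes> y) \<otimes> (b \<otimes> c)) =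
      r \<otimes> d \<oplus> s \<otimes> c \<otimes> (x \<otimes> a \<oplus> y \<otimes> b)"
    using x(1-4) r(1-4) by algebra
  also have "\<dots> = \<one>"
    using x r by simp
  finally have "(s \<otimes> x) \<otimes> (a \<otimes> c) \<oplus> (r \<otimes> d \<oplus> (s \<otimes> y) \<otimes> (b \<otimes> c)) = \<one>" .
  moreover have "s \<otimes> x \<in> carrier R" "s \<otimes> y \<in> carrier R" "a \<otimes> c \<in> carrier R" "b \<otimes> c \<in> carrier R"
    using x(1-4) r(1-4) by simp_all
  ultimately show ?thesis
    unfolding Um3_iff using r(1,3) by blast
qed

text \<open>In ac x1 y1 + d x1 y2 + bc x2 y2 = 1 the last two terms are multiples of y2 and the
  first two are multiples of x1. Hence y2 is a unit modulo ac and x1 is a unit modulo bc.\<close>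

lemma SE2_triangle_imp_U2:
  assumes "SE2_triangle_ring R" shows "U2_ring R"
proof (rule U2_ringI)
  fix a b c d
  assume ab: "[a, b] \<in> Um R 2" and c: "c \<in> carrier R" and dc: "[d, c] \<in> Um R 2"
  have carr: "a \<in> carrier R" "b \<in> carrier R" "d \<in> carrier R"
    using ab dc by (auto simp: Um2_iff)
  obtain x1 x2 y1 y2 where xy: "x1 \<in> carrier R" "x2 \<in> carrier R" "y1 \<in> carrier R"
    "y2 \<in> carrier R"
    and eq: "(a \<otimes> c) \<otimes> (x1 \<otimes> y1) \<oplus> d \<otimes> (x1 \<otimes> y2) \<oplus> (b \<otimes> c) \<otimes> (x2 \<otimes> y2) = \<one>"
    using SE2_triangle_Um3[OF assms Um3_conductor[OF ab dc]] .
  have "(d \<otimes> x1 \<oplus> b \<otimes> c \<otimes> x2) \<otimes> y2 \<oplus> (x1 \<otimes> y1) \<otimes> (a \<otimes> c) = \<one>"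
    unfolding eq[symmetric] using carr c xy by algebra
  then have y2: "[y2, a \<otimes> c] \<in> Um R 2"
    by (rule Um2I) (use carr c xy in simp_all)
  have "(a \<otimes> c \<otimes> y1 \<oplus> d \<otimes> y2) \<otimes> x1 \<oplus> (x2 \<otimes> y2) \<otimes> (b \<otimes> c) = \<one>"
    unfolding eq[symmetric] using carr c xy by algebra
  then have x1: "[x1, b \<otimes> c] \<in> Um R 2"
    by (rule Um2I) (use carr c xy in simp_all)
  have one: "[\<one>, m] \<in> Um R 2" if "m \<in> carrier R" for m
    using that by (intro Um2I[of \<one> _ \<zero>]) simp_all
  \<comment> \<open>Modulo c only the middle term survives, so d is the inverse of y2 x1 and both
    numerators are 1.\<close>
  have "y2 \<otimes> x1 \<otimes> d \<oplus> (a \<otimes> (x1 \<otimes> y1) \<oplus> b \<otimes> (x2 \<otimes> y2)) \<otimes> c = \<one>"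
    unfolding eq[symmetric] using carr c xy by algebra
  then have "y2 \<otimes> x1 \<otimes> d \<oplus> (a \<otimes> (x1 \<otimes> y1) \<oplus> b \<otimes> (x2 \<otimes> y2)) \<otimes> c = \<one> \<otimes> \<one>"
    by simp
  moreover have "a \<otimes> (x1 \<otimes> y1) \<oplus> b \<otimes> (x2 \<otimes> y2) \<in> carrier R"
    using carr xy by simp
  ultimately show "\<exists>s1 s2 t1 t2. \<exists>k\<in>carrier R. [s1, a \<otimes> c] \<in> Um R 2 \<and> [s2, a \<otimes> c] \<in> Um R 2 \<and>
      [t1, b \<otimes> c] \<in> Um R 2 \<and> [t2, b \<otimes> c] \<in> Um R 2 \<and> s1 \<otimes> t1 \<otimes> d \<oplus> k \<otimes> c = s2 \<otimes> t2"
    using y2 x1 one[OF m_closed[OF carr(1) c]] one[OF m_closed[OF carr(2) c]] by blast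
qed

text \<open>A product that is a unit modulo m has unit factors. This applies to u v, and to p q
  because p q is congruent to v modulo m.\<close>

lemma Um2_factors_mod:
  assumes um: "[m, u \<otimes> v] \<in> Um R 2" and carr: "u \<in> carrier R" "v \<in> carrier R" "x \<in> carrier R"
    "p \<in> carrier R" "q \<in> carrier R" and eq: "v \<ominus> m \<otimes> x = p \<otimes> q"
  shows "[u, m] \<in> Um R 2" "[p, m] \<in> Um R 2" "[q, m] \<in> Um R 2"
proof -
  obtain r s where r: "m \<in> carrier R" "r \<in> carrier R" "s \<in> carrier R" "r \<otimes> m \<oplus> s \<otimes> (u \<otimes> v) = \<one>"
    using um by (auto simp: Um2_iff)
  have u: "(s \<otimes> v) \<otimes> u \<oplus> r \<otimes> m = \<one>"
    unfolding r(4)[symmetric] using r(1-3) carr by algebra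
  have "(s \<otimes> u) \<otimes> (v \<ominus> m \<otimes> x) \<oplus> (r \<oplus> s \<otimes> u \<otimes> x) \<otimes> m = \<one>"
    unfolding r(4)[symmetric] using r(1-3) carr by algebra
  then have pq: "(s \<otimes> u) \<otimes> (p \<otimes> q) \<oplus> (r \<oplus> s \<otimes> u \<otimes> x) \<otimes> m = \<one>"
    by (simp only: eq)
  have p: "(s \<otimes> u \<otimes> q) \<otimes> p \<oplus> (r \<oplus> s \<otimes> u \<otimes> x) \<otimes> m = \<one>"
    unfolding pq[symmetric] using r(1-3) carr by algebra
  have q: "(s \<otimes> u \<otimes> p) \<otimes> q \<oplus> (r \<oplus> s \<otimes> u \<otimes> x) \<otimes> m = \<one>"
    unfolding pq[symmetric] using r(1-3) carr by algebra
  show "[u, m] \<in> Um R 2"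
    using u by (rule Um2I) (use r(1-3) carr in simp_all)
  show "[p, m] \<in> Um R 2"
    using p by (rule Um2I) (use r(1-3) carr in simp_all)
  show "[q, m] \<in> Um R 2"
    using q by (rule Um2I) (use r(1-3) carr in simp_all)
qed

text \<open>The WV_2 data are the entries of a singular unimodular matrix M, which factors as p q^T.
  Its diagonal is a'' modulo \<alpha> and c'' modulo \<gamma>, so q1 is a unit modulo \<alpha> and
  p2 is a unit modulo \<gamma>. Its lower left entry p2 q1 is a' c' d modulo c, which writes d as
  the product of the fractions q1/a' and p2/c'.\<close>

lemma Pi2_WV2_imp_U2:
  assumes Pi2: "Pi2_ring R" and WV2: "WV2_ring R"
  shows "U2_ring R"
proof (rule U2_ringI)
  fix a b c d
  assume ab: "[a, b] \<in> Um R 2" and c: "c \<in> carrier R" and dc: "[d, c] \<in> Um R 2"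
  have carr: "a \<in> carrier R" "b \<in> carrier R" "d \<in> carrier R"
    using ab dc by (auto simp: Um2_iff)
  define \<alpha> \<gamma> where "\<alpha> = a \<otimes> c" and "\<gamma> = b \<otimes> c"
  have \<alpha>\<gamma>: "\<alpha> \<in> carrier R" "\<gamma> \<in> carrier R"
    using carr c by (simp_all add: \<alpha>_def \<gamma>_def)
  have um3: "[\<alpha>, d, \<gamma>] \<in> Um R 3"
    using Um3_conductor[OF ab dc] by (simp add: \<alpha>_def \<gamma>_def)
  obtain x y z1 z2 w a' c' a'' c'' where
    wv: "x \<in> carrier R" "y \<in> carrier R" "z1 \<in> carrier R" "z2 \<in> carrier R" "w \<in> carrier R"
      "a' \<in> carrier R" "c' \<in> carrier R" "a'' \<in> carrier R" "c'' \<in> carrier R"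
    and um4: "[a'' \<ominus> \<alpha> \<otimes> x, y, a' \<otimes> c' \<otimes> d \<oplus> \<alpha> \<otimes> z1 \<oplus> \<gamma> \<otimes> z2, c'' \<ominus> \<gamma> \<otimes> w] \<in> Um R 4"
    and um_a: "[\<alpha>, a' \<otimes> a''] \<in> Um R 2" and um_c: "[\<gamma>, c' \<otimes> c''] \<in> Um R 2"
    and det: "(a'' \<ominus> \<alpha> \<otimes> x) \<otimes> (c'' \<ominus> \<gamma> \<otimes> w) = y \<otimes> (a' \<otimes> c' \<otimes> d \<oplus> \<alpha> \<otimes> z1 \<oplus> \<gamma> \<otimes> z2)"
    using WV2[unfolded WV2_ring_def, rule_format, OF um3] by (elim bexE conjE)
  define M where "M = mat2 (a'' \<ominus> \<alpha> \<otimes> x) y (a' \<otimes> c' \<otimes> d \<oplus> \<alpha> \<otimes> z1 \<oplus> \<gamma> \<otimes> z2) (c'' \<ominus> \<gamma> \<otimes> w)"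
  have M: "M \<in> Um_mat2 R"
    using um4 wv \<alpha>\<gamma> carr by (simp add: M_def Um_mat2_iff)
  have M0: "det2 R M = \<zero>"
    unfolding M_def det2_mat2 det using wv \<alpha>\<gamma> carr by (simp add: a_minus_def r_neg)
  obtain p1 p2 q1 q2 where "rank_one M p1 p2 q1 q2"
    by (rule Pi2_det_zero_rank_one[OF Pi2 M M0])
  then have pq: "p1 \<in> carrier R" "p2 \<in> carrier R" "q1 \<in> carrier R" "q2 \<in> carrier R"
    and eqs: "a'' \<ominus> \<alpha> \<otimes> x = p1 \<otimes> q1" "a' \<otimes> c' \<otimes> d \<oplus> \<alpha> \<otimes> z1 \<oplus> \<gamma> \<otimes> z2 = p2 \<otimes> q1"
      "c'' \<ominus> \<gamma> \<otimes> w = p2 \<otimes> q2"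
    by (simp_all add: rank_one_def M_def)
  note units_a = Um2_factors_mod[OF um_a wv(6,8,1) pq(1,3) eqs(1)]
  note units_c = Um2_factors_mod[OF um_c wv(7,9,5) pq(2,4) eqs(3)]
  have "a' \<otimes> c' \<otimes> d \<oplus> (a \<otimes> z1 \<oplus> b \<otimes> z2) \<otimes> c = a' \<otimes> c' \<otimes> d \<oplus> \<alpha> \<otimes> z1 \<oplus> \<gamma> \<otimes> z2"
    unfolding \<alpha>_def \<gamma>_def using carr c wv by algebra
  also have "\<dots> = q1 \<otimes> p2"
    using eqs(2) pq by (simp add: m_comm)
  finally have "a' \<otimes> c' \<otimes> d \<oplus> (a \<otimes> z1 \<oplus> b \<otimes> z2) \<otimes> c = q1 \<otimes> p2" .
  moreover have "a \<otimes> z1 \<oplus> b \<otimes> z2 \<in> carrier R"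
    using carr wv by simp
  ultimately show "\<exists>s1 s2 t1 t2. \<exists>k\<in>carrier R. [s1, a \<otimes> c] \<in> Um R 2 \<and> [s2, a \<otimes> c] \<in> Um R 2 \<and>
      [t1, b \<otimes> c] \<in> Um R 2 \<and> [t2, b \<otimes> c] \<in> Um R 2 \<and> s1 \<otimes> t1 \<otimes> d \<oplus> k \<otimes> c = s2 \<otimes> t2"
    using units_a(1,3) units_c(1,2) unfolding \<alpha>_def \<gamma>_def by blast
qed

end

section \<open>Quotient rings\<close>

text \<open>B is compared with the image of A only on the block, because matrix values at other
  indices are arbitrary.\<close>

lemma (in ring_hom_cring) bilin_hom:
  assumes "A \<in> mats R 2" "x1 \<in> carrier R" "x2 \<in> carrier R" "y1 \<in> carrier R" "y2 \<in> carrier R"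
    and B: "\<forall>i<2. \<forall>j<2. B i j = h (A i j)"
  shows "bilin S B (h x1) (h x2) (h y1) (h y2) = h (bilin R A x1 x2 y1 y2)"
  using assms(1-5) B by (simp add: bilin_def R.mats2_iff)

lemma (in ring_hom_cring) det2_hom:
  assumes "A \<in> mats R 2" and B: "\<forall>i<2. \<forall>j<2. B i j = h (A i j)"
  shows "det2 S B = h (det2 R A)"
  using assms by (simp add: det2_def R.mats2_iff a_minus_def)

lemma (in ring_hom_cring) mats_hom:
  assumes "A \<in> mats R 2" and B: "\<forall>i<2. \<forall>j<2. B i j = h (A i j)"
  shows "B \<in> mats S 2"
  using assms by (simp add: mats_def)

lemma (in ring_hom_cring) extendable_hom:
  assumes A: "A \<in> mats R 2" and B: "\<forall>i<2. \<forall>j<2. B i j = h (A i j)"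
  shows "extendable R A \<Longrightarrow> extendable S B"
    and "simply_extendable R A \<Longrightarrow> simply_extendable S B"
proof -
  note B' = mats_hom[OF A B]
  show "extendable S B" if "extendable R A"
  proof -
    obtain x1 x2 y1 y2 v where x: "x1 \<in> carrier R" "x2 \<in> carrier R" "y1 \<in> carrier R"
      "y2 \<in> carrier R" and v: "v \<in> carrier R"
      and eq: "bilin R A x1 x2 y1 y2 \<oplus> v \<otimes> det2 R A = \<one>"
      using \<open>extendable R A\<close> by (auto simp: R.extendable_iff[OF A])
    have "bilin S B (h x1) (h x2) (h y1) (h y2) \<oplus>\<^bsub>S\<^esub> h v \<otimes>\<^bsub>S\<^esub> det2 S B = h \<one>"
      unfolding eq[symmetric] bilin_hom[OF A x B] det2_hom[OF A B] using A x v by simp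
    then have "bilin S B (h x1) (h x2) (h y1) (h y2) \<oplus>\<^bsub>S\<^esub> h v \<otimes>\<^bsub>S\<^esub> det2 S B = \<one>\<^bsub>S\<^esub>"
      by simp
    then show ?thesis
      unfolding S.extendable_iff[OF B'] using x v hom_closed by blast
  qed
  show "simply_extendable S B" if "simply_extendable R A"
  proof -
    obtain x1 x2 y1 y2 where x: "x1 \<in> carrier R" "x2 \<in> carrier R" "y1 \<in> carrier R"
      "y2 \<in> carrier R" and eq: "bilin R A x1 x2 y1 y2 = \<one>"
      using \<open>simply_extendable R A\<close> by (auto simp: R.simply_extendable_iff[OF A])
    have "bilin S B (h x1) (h x2) (h y1) (h y2) = \<one>\<^bsub>S\<^esub>"
      unfolding bilin_hom[OF A x B] eq by simp
    then show ?thesis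
      unfolding S.simply_extendable_iff[OF B'] using x hom_closed by blast
  qed
qed

lemma (in ring_hom_cring) Um_mat2_hom:
  assumes A: "A \<in> Um_mat2 R" and B: "\<forall>i<2. \<forall>j<2. B i j = h (A i j)"
  shows "B \<in> Um_mat2 S"
proof -
  have A': "A \<in> mats R 2"
    using A by (simp add: Um_mat2_def)
  then have carr: "A 0 0 \<in> carrier R" "A 0 1 \<in> carrier R" "A 1 0 \<in> carrier R" "A 1 1 \<in> carrier R"
    by (simp_all add: R.mats2_iff)
  obtain r s t u where r: "r \<in> carrier R" "s \<in> carrier R" "t \<in> carrier R" "u \<in> carrier R"
    and eq: "r \<otimes> A 0 0 \<oplus> (s \<otimes> A 0 1 \<oplus> (t \<otimes> A 1 0 \<oplus> u \<otimes> A 1 1)) = \<one>"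
    using A by (auto simp: R.Um_mat2_iff R.Um4_iff)
  have B_eq: "B 0 0 = h (A 0 0)" "B 0 1 = h (A 0 1)" "B 1 0 = h (A 1 0)" "B 1 1 = h (A 1 1)"
    using B by simp_all
  have "h r \<otimes>\<^bsub>S\<^esub> B 0 0 \<oplus>\<^bsub>S\<^esub> (h s \<otimes>\<^bsub>S\<^esub> B 0 1 \<oplus>\<^bsub>S\<^esub> (h t \<otimes>\<^bsub>S\<^esub> B 1 0 \<oplus>\<^bsub>S\<^esub> h u \<otimes>\<^bsub>S\<^esub> B 1 1)) =
      h (r \<otimes> A 0 0 \<oplus> (s \<otimes> A 0 1 \<oplus> (t \<otimes> A 1 0 \<oplus> u \<otimes> A 1 1)))"
    unfolding B_eq using carr r by simp
  also have "\<dots> = \<one>\<^bsub>S\<^esub>"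
    unfolding eq by simp
  finally have "h r \<otimes>\<^bsub>S\<^esub> B 0 0 \<oplus>\<^bsub>S\<^esub>
    (h s \<otimes>\<^bsub>S\<^esub> B 0 1 \<oplus>\<^bsub>S\<^esub> (h t \<otimes>\<^bsub>S\<^esub> B 1 0 \<oplus>\<^bsub>S\<^esub> h u \<otimes>\<^bsub>S\<^esub> B 1 1)) = \<one>\<^bsub>S\<^esub>" .
  moreover have B': "B \<in> mats S 2"
    using mats_hom[OF A' B] .
  ultimately show ?thesis
    unfolding S.Um_mat2_iff S.Um4_iff using r hom_closed S.mats2_iff by blast
qed

section \<open>Lifting matrices and relations from quotients by principal ideals\<close>

context cring
begin

lemma quot_PIdl_hom: "a \<in> carrier R \<Longrightarrow> ring_hom_cring R (R Quot PIdl a) ((+>) (PIdl a))"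
  using ideal.rcos_ring_hom_cring[OF cgenideal_ideal is_cring] .

lemma mats2_quot_lift:
  assumes "B \<in> mats (R Quot J) 2"
  obtains A where "A \<in> mats R 2" "\<forall>i<2. \<forall>j<2. B i j = J +> A i j"
proof -
  have "\<exists>x. x \<in> carrier R \<and> B i j = J +> x" if "i < 2" "j < 2" for i j
  proof -
    have "B i j \<in> carrier (R Quot J)"
      using assms that by (simp add: mats_def)
    then show ?thesis
      by (auto elim: quot_carrierE)
  qed
  then obtain A where "\<And>i j. i < 2 \<Longrightarrow> j < 2 \<Longrightarrow> A i j \<in> carrier R \<and> B i j = J +> A i j"
    by metis
  then show ?thesis
    by (intro that[of A]) (auto simp: mats_def)
qed

lemma Pi2_quotients_imp_E2:
  assumes Pi2: "\<And>a. a \<in> carrier R \<Longrightarrow> Pi2_ring (R Quot PIdl a)"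
  shows "E2_ring R"
  unfolding E2_ring_def
proof
  fix A assume A: "A \<in> Um_mat2 R"
  then have A': "A \<in> mats R 2"
    by (simp add: Um_mat2_def)
  define D where "D = det2 R A"
  have D: "D \<in> carrier R"
    using A' by (simp add: D_def)
  interpret h: ring_hom_cring R "R Quot PIdl D" "(+>) (PIdl D)"
    using quot_PIdl_hom[OF D] .
  interpret I: ideal "PIdl D" R
    using cgenideal_ideal[OF D] .
  define B where "B i j = PIdl D +> A i j" for i j
  have B_eq: "\<forall>i<2. \<forall>j<2. B i j = PIdl D +> A i j"
    by (simp add: B_def)
  have B: "B \<in> mats (R Quot PIdl D) 2"
    using h.mats_hom[OF A' B_eq] .
  have "det2 (R Quot PIdl D) B = PIdl D +> D"
    using h.det2_hom[OF A' B_eq] by (simp add: D_def)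
  also have "\<dots> = PIdl D"
    using a_rcos_zero[OF I.is_ideal cgenideal_self[OF D]] .
  also have "PIdl D = \<zero>\<^bsub>R Quot PIdl D\<^esub>"
    unfolding FactRing_def ring.simps ..
  finally have det: "det2 (R Quot PIdl D) B = \<zero>\<^bsub>R Quot PIdl D\<^esub>" .
  have "extendable (R Quot PIdl D) B"
    using Pi2[OF D] h.Um_mat2_hom[OF A B_eq] det by (simp add: Pi2_ring_def)
  then have "simply_extendable (R Quot PIdl D) B"
    using h.S.extendable_det_zero[OF B det] by simp
  then obtain X1 X2 Y1 Y2 where X: "X1 \<in> carrier (R Quot PIdl D)" "X2 \<in> carrier (R Quot PIdl D)"
    "Y1 \<in> carrier (R Quot PIdl D)" "Y2 \<in> carrier (R Quot PIdl D)"
    and eq: "bilin (R Quot PIdl D) B X1 X2 Y1 Y2 = \<one>\<^bsub>R Quot PIdl D\<^esub>"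
    by (auto simp: h.S.simply_extendable_iff[OF B])
  obtain x1 where x1: "x1 \<in> carrier R" "X1 = PIdl D +> x1"
    using X(1) by (rule quot_carrierE)
  obtain x2 where x2: "x2 \<in> carrier R" "X2 = PIdl D +> x2"
    using X(2) by (rule quot_carrierE)
  obtain y1 where y1: "y1 \<in> carrier R" "Y1 = PIdl D +> y1"
    using X(3) by (rule quot_carrierE)
  obtain y2 where y2: "y2 \<in> carrier R" "Y2 = PIdl D +> y2"
    using X(4) by (rule quot_carrierE)
  let ?w = "bilin R A x1 x2 y1 y2"
  have w: "?w \<in> carrier R"
    using A' x1 x2 y1 y2 by simp
  have "PIdl D +> ?w = PIdl D +> \<one>"
    using h.bilin_hom[OF A' x1(1) x2(1) y1(1) y2(1) B_eq] eq x1(2) x2(2) y1(2) y2(2) by simp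
  then have "?w \<ominus> \<one> \<in> PIdl D"
    using quotient_eq_iff_same_a_r_cos[OF I.is_ideal w one_closed] by simp
  then obtain n where n: "n \<in> carrier R" "?w = \<one> \<oplus> D \<otimes> n"
    using eq_add_of_minus_mem_PIdl[OF _ w one_closed D] by blast
  \<comment> \<open>The error D n of the lifted relation is absorbed by the corner entry -n.\<close>
  have "?w \<oplus> (\<ominus> n) \<otimes> D = \<one> \<oplus> D \<otimes> n \<oplus> (\<ominus> n) \<otimes> D"
    by (simp only: n(2))
  also have "\<dots> = \<one>"
    using n(1) D by algebra
  finally have "?w \<oplus> (\<ominus> n) \<otimes> det2 R A = \<one>"
    by (simp add: D_def)
  then show "extendable R A"
    unfolding extendable_iff[OF A'] using x1(1) x2(1) y1(1) y2(1) n(1) a_inv_closed by blast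
qed

text \<open>The bound 4 on the stable range enters because the four entries and \<open>a\<close> form a 5-tuple.\<close>

lemma Um_mat2_quot_lift:
  assumes sr: "sr R \<le> 4" and a: "a \<in> carrier R" and B: "B \<in> Um_mat2 (R Quot PIdl a)"
  obtains A where "A \<in> Um_mat2 R" "\<forall>i<2. \<forall>j<2. B i j = PIdl a +> A i j"
proof -
  let ?Q = "R Quot PIdl a"
  interpret h: ring_hom_cring R ?Q "(+>) (PIdl a)"
    using quot_PIdl_hom[OF a] .
  have "B \<in> mats ?Q 2"
    using B by (simp add: Um_mat2_def)
  then obtain A where A: "A \<in> mats R 2" and BA: "\<forall>i<2. \<forall>j<2. B i j = PIdl a +> A i j"
    by (rule mats2_quot_lift)
  have A': "A 0 0 \<in> carrier R" "A 0 1 \<in> carrier R" "A 1 0 \<in> carrier R" "A 1 1 \<in> carrier R"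
    using A by (simp_all add: mats2_iff)
  obtain r' s' t' u' where R: "r' \<in> carrier ?Q" "s' \<in> carrier ?Q" "t' \<in> carrier ?Q" "u' \<in> carrier ?Q"
    and one: "r' \<otimes>\<^bsub>?Q\<^esub> B 0 0 \<oplus>\<^bsub>?Q\<^esub>
      (s' \<otimes>\<^bsub>?Q\<^esub> B 0 1 \<oplus>\<^bsub>?Q\<^esub> (t' \<otimes>\<^bsub>?Q\<^esub> B 1 0 \<oplus>\<^bsub>?Q\<^esub> u' \<otimes>\<^bsub>?Q\<^esub> B 1 1)) = \<one>\<^bsub>?Q\<^esub>"
    using B by (auto simp: h.S.Um_mat2_iff h.S.Um4_iff)
  obtain r where r: "r \<in> carrier R" "r' = PIdl a +> r"
    using R(1) by (rule quot_carrierE)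
  obtain s where s: "s \<in> carrier R" "s' = PIdl a +> s"
    using R(2) by (rule quot_carrierE)
  obtain t where t: "t \<in> carrier R" "t' = PIdl a +> t"
    using R(3) by (rule quot_carrierE)
  obtain u where u: "u \<in> carrier R" "u' = PIdl a +> u"
    using R(4) by (rule quot_carrierE)
  define w where "w = r \<otimes> A 0 0 \<oplus> (s \<otimes> A 0 1 \<oplus> (t \<otimes> A 1 0 \<oplus> u \<otimes> A 1 1))"
  have w: "w \<in> carrier R"
    using A' r(1) s(1) t(1) u(1) by (simp add: w_def)
  have B_eq: "B 0 0 = PIdl a +> A 0 0" "B 0 1 = PIdl a +> A 0 1" "B 1 0 = PIdl a +> A 1 0"
    "B 1 1 = PIdl a +> A 1 1"
    using BA by simp_all
  have "PIdl a +> w = PIdl a +> \<one>"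
    using one A' r(1) s(1) t(1) u(1) unfolding w_def B_eq r(2) s(2) t(2) u(2) by simp
  then have "w \<ominus> \<one> \<in> PIdl a"
    using quotient_eq_iff_same_a_r_cos[OF cgenideal_ideal[OF a] w one_closed] by simp
  then obtain n where n: "n \<in> carrier R" "w = \<one> \<oplus> a \<otimes> n"
    using eq_add_of_minus_mem_PIdl[OF _ w one_closed a] by blast
  \<comment> \<open>The entrywise lift A need not be unimodular, but its entries together with a
    are.\<close>
  define J where "J = Idl {A 0 0, A 0 1, A 1 0, A 1 1, a}"
  have sub: "{A 0 0, A 0 1, A 1 0, A 1 1, a} \<subseteq> carrier R"
    using A' a by simp
  interpret J: ideal J R
    unfolding J_def by (rule genideal_ideal[OF sub])
  have gen: "A 0 0 \<in> J" "A 0 1 \<in> J" "A 1 0 \<in> J" "A 1 1 \<in> J" "a \<in> J"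
    using genideal_self[OF sub] unfolding J_def by auto
  have "w \<oplus> (\<ominus> n) \<otimes> a \<in> J"
    unfolding w_def using gen r(1) s(1) t(1) u(1) n(1)
    by (intro J.a_closed J.I_l_closed a_inv_closed)
  moreover have "\<one> \<oplus> a \<otimes> n \<oplus> (\<ominus> n) \<otimes> a = \<one>"
    using n(1) a by algebra
  ultimately have "\<one> \<in> J"
    by (simp only: n(2))
  then have "[A 0 0, A 0 1, A 1 0, A 1 1] @ [a] \<in> Um R (4 + 1)"
    using A' a by (simp add: Um_iff J_def)
  moreover have "stable_range_condition R 4"
    using sr sr_le_imp_stable_range_condition[of 4] by (simp add: numeral_eq_enat)
  ultimately obtain rs where rs: "length rs = 4" "set rs \<subseteq> carrier R"
    and um: "map2 (\<lambda>x r. x \<oplus> a \<otimes> r) [A 0 0, A 0 1, A 1 0, A 1 1] rs \<in> Um R 4"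
    unfolding stable_range_condition_def by blast
  obtain k1 k2 k3 k4 where rs_eq: "rs = [k1, k2, k3, k4]"
    using rs(1) by (auto simp: length_Suc_conv numeral_eq_Suc)
  have k: "k1 \<in> carrier R" "k2 \<in> carrier R" "k3 \<in> carrier R" "k4 \<in> carrier R"
    using rs(2) by (simp_all add: rs_eq)
  \<comment> \<open>The stable range condition changes the lift by multiples of a only, so C is
    unimodular and still lies over B.\<close>
  define C where "C = mat2 (A 0 0 \<oplus> a \<otimes> k1) (A 0 1 \<oplus> a \<otimes> k2) (A 1 0 \<oplus> a \<otimes> k3) (A 1 1 \<oplus> a \<otimes> k4)"
  have "C \<in> Um_mat2 R"
    using um A' a k by (simp add: C_def Um_mat2_iff rs_eq)
  moreover have shift: "PIdl a +> (x \<oplus> a \<otimes> y) = PIdl a +> x" if "x \<in> carrier R" "y \<in> carrier R" for x y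
    using quotient_eq_iff_same_a_r_cos[OF cgenideal_ideal[OF a], of "x \<oplus> a \<otimes> y" x]
      minus_mem_PIdlI[OF refl that(2,1) a] that a by simp
  then have "\<forall>i<2. \<forall>j<2. B i j = PIdl a +> C i j"
    using BA A' k by (auto simp: less_2_cases_iff C_def)
  ultimately show ?thesis
    by (rule that)
qed

text \<open>A unimodular lift is extendable over R, and ring homomorphisms carry the extension back
  to the quotient.\<close>

lemma E2_quotient:
  assumes "sr R \<le> 4" "E2_ring R" "a \<in> carrier R"
  shows "E2_ring (R Quot PIdl a)"
  unfolding E2_ring_def
proof
  interpret h: ring_hom_cring R "R Quot PIdl a" "(+>) (PIdl a)"
    using quot_PIdl_hom[OF assms(3)] .
  fix B assume "B \<in> Um_mat2 (R Quot PIdl a)"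
  with assms(1,3) obtain A where A: "A \<in> Um_mat2 R" and B: "\<forall>i<2. \<forall>j<2. B i j = PIdl a +> A i j"
    by (rule Um_mat2_quot_lift)
  show "extendable (R Quot PIdl a) B"
    using A assms(2) by (intro h.extendable_hom(1)[OF _ B]) (auto simp: Um_mat2_def E2_ring_def)
qed

lemma SE2_quotient:
  assumes "sr R \<le> 4" "SE2_ring R" "a \<in> carrier R"
  shows "SE2_ring (R Quot PIdl a)"
  unfolding SE2_ring_def
proof
  interpret h: ring_hom_cring R "R Quot PIdl a" "(+>) (PIdl a)"
    using quot_PIdl_hom[OF assms(3)] .
  fix B assume "B \<in> Um_mat2 (R Quot PIdl a)"
  with assms(1,3) obtain A where A: "A \<in> Um_mat2 R" and B: "\<forall>i<2. \<forall>j<2. B i j = PIdl a +> A i j"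
    by (rule Um_mat2_quot_lift)
  show "simply_extendable (R Quot PIdl a) B"
    using A assms(2) by (intro h.extendable_hom(2)[OF _ B]) (auto simp: Um_mat2_def SE2_ring_def)
qed

end

theorem theorem1p11:
  fixes R :: "('a, 'm) ring_scheme"
  assumes "cring R"
  shows
    "((E2_ring R \<longrightarrow> WZ2_ring R) \<and>
      (SE2_ring R \<longrightarrow> Z2_ring R) \<and>
      (sr R \<le> 2 \<and> E2_ring R \<longrightarrow> Z2_ring R)) \<and>
     (\<forall>(I :: 'i set) (D :: 'i \<Rightarrow> ('b, 'n) ring_scheme).
      (\<forall>i\<in>I. pre_schreier_domain (D i)) \<and> R \<simeq> product_ring I D \<longrightarrow>
        (E2_ring R \<longleftrightarrow> WZ2_ring R)) \<and>
     (Pi2_ring R \<longrightarrow> (SE2_ring R \<longleftrightarrow> Z2_ring R)) \<and>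
     ((SE2_triangle_ring R \<longrightarrow> V2_ring R) \<and>
      (domain R \<and> SE2_triangle_ring R \<longrightarrow> U2_ring R) \<and>
      (Pi2_ring R \<and> WV2_ring R \<longrightarrow> U2_ring R)) \<and>
     (sr R \<le> 4 \<longrightarrow>
      (E2_ring R \<longrightarrow> (\<forall>a\<in>carrier R. E2_ring (R Quot PIdl\<^bsub>R\<^esub> a))) \<and>
      (SE2_ring R \<longrightarrow> (\<forall>a\<in>carrier R. SE2_ring (R Quot PIdl\<^bsub>R\<^esub> a)))) \<and>
     ((\<forall>a\<in>carrier R. Pi2_ring (R Quot PIdl\<^bsub>R\<^esub> a)) \<longrightarrow> E2_ring R)"
proof -
  interpret cring R
    by fact
  have "\<forall>(I :: 'i set) (D :: 'i \<Rightarrow> ('b, 'n) ring_scheme).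
      (\<forall>i\<in>I. pre_schreier_domain (D i)) \<and> R \<simeq> product_ring I D \<longrightarrow>
        (E2_ring R \<longleftrightarrow> WZ2_ring R)"
  proof (intro allI impI iffI)
    fix I :: "'i set" and D :: "'i \<Rightarrow> ('b, 'n) ring_scheme"
    assume "(\<forall>i\<in>I. pre_schreier_domain (D i)) \<and> R \<simeq> product_ring I D" and "WZ2_ring R"
    then show "E2_ring R"
      using pre_schreier_product_WZ2_imp_E2[of I D] by simp
  qed (rule E2_imp_WZ2)
  moreover have "SE2_ring R \<longleftrightarrow> Z2_ring R" if "Pi2_ring R"
    using SE2_imp_Z2 Pi2_Z2_imp_SE2[OF that] by blast
  ultimately show ?thesis
    using E2_imp_WZ2 SE2_imp_Z2 sr_le_2_E2_imp_Z2 SE2_triangle_imp_V2 SE2_triangle_imp_U2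
      Pi2_WV2_imp_U2 E2_quotient SE2_quotient Pi2_quotients_imp_E2
    by simp
qed

end
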